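(* Let $\mathfrak n$ be a $k$-step nilpotent real Lie algebra which decomposes as a direct sum of ideals $\mathfrak n=\mathbb R\oplus\mathfrak h$ (the first ideal being one-dimensional). Denote by $\{E_r^{p,q}\}$ and $\{\tilde E_r^{p,q}\}$ the spectral sequences associated to $\mathfrak n$ and to $\mathfrak h$, respectively. Then for every $r\ge 0$ and all $p,q\in\mathbb Z$: (1) $E_r^{p,q}=0$ if $p+q<0$; (2) $E_r^{k-1,1-k}\simeq\mathbb R$, and $E_r^{p,-p}=0$ for all $p\ne k-1$; (3) $E_r^{k-1,2-k}\simeq\tilde E_r^{k-1,2-k}\oplus\mathbb R$; (4) $E_r^{p,1-p}\simeq\tilde E_r^{p,1-p}$ if $0\le p\le k-2$, and $E_r^{p,1-p}=0$ if $p<0$ or $p\ge k$; (5) $E_r^{p,q}\simeq\tilde E_r^{p,q}\oplus\tilde E_r^{p,q-1}$ if $p+q\ge2$.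
   Context: All Lie algebras are real, finite dimensional and nonzero. The central descending series of $\mathfrak n$ is $\mathfrak n^0=\mathfrak n$, $\mathfrak n^i=[\mathfrak n,\mathfrak n^{i-1}]$ for $i\ge1$; $\mathfrak n$ is $k$-step nilpotent if $\mathfrak n^k=0$ and $\mathfrak n^{k-1}\ne0$ (so nonzero abelian Lie algebras are 1-step nilpotent). The Chevalley-Eilenberg complex of $\mathfrak n$ is $C^q=\Lambda^q\mathfrak n^*$ (with $C^0=\mathbb R$, $d=0$ on $C^0$), with differential $d:\Lambda^s\mathfrak n^*\to\Lambda^{s+1}\mathfrak n^*$, $dx(u_1,\ldots,u_{s+1})=\sum_{i<j}(-1)^{i+j-1}x([u_i,u_j],u_1,\ldots,\hat u_i,\ldots,\hat u_j,\ldots,u_{s+1})$. For a $k$-step nilpotent Lie algebra $\mathfrak n$, set $V_i=0$ for $i\le0$ and $V_i=\{x\in\mathfrak n^*: dx\in\Lambda^2V_{i-1}\}$ for $i\ge1$. Then $V_i$ is the annihilator of $\mathfrak n^i$ for $i\ge 0$, and $V_i=\mathfrak n^*$ for $i\ge k$. Define a decreasing filtration of the complex $C^*$ by subcomplexes: $F^pC^q=\Lambda^qV_{k-p}$ for $p\le k-1$ (with $\Lambda^0V_{k-p}=\mathbb R$), and $F^pC^q=0$ for all $q$ if $p\ge k$; thus $F^pC^*=C^*$ for $p\le0$. The spectral sequence associated to $\mathfrak n$ is the cohomological spectral sequence $\{E_r^{p,q}\}$ ($r\ge0$, $p,q\in\mathbb Z$) of this filtered complex: with $A_r^{p,q}=\{x\in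 F^pC^{p+q}: dx\in F^{p+r}C^{p+q+1}\}$, $$E_r^{p,q}=\frac{A_r^{p,q}}{d(A_{r-1}^{p-r+1,q+r-2})+A_{r-1}^{p+1,q-1}},$$ and $d_r^{p,q}:E_r^{p,q}\to E_r^{p+r,q-r+1}$ is induced by $d$; in particular $E_0^{p,q}=F^pC^{p+q}/F^{p+1}C^{p+q}$. The spectral sequence of $\mathfrak h$ is defined in the same way, from the Chevalley-Eilenberg complex and the nilpotency index of $\mathfrak h$ (nilpotent as an ideal of $\mathfrak n$). *)

theory Defs
  imports
    Complex_Main
    "HOL-Library.Function_Algebras"
    "HOL-Library.Set_Algebras"
    "Jordan_Normal_Form.Determinant"
begin

text \<open>
  Pointwise real vector space structure on functions. It makes the subspaces, spans and quotients
  below available for spaces of multilinear forms.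
\<close>

instantiation "fun" :: (type, real_vector) real_vector
begin

definition scaleR_fun :: "real \<Rightarrow> ('a \<Rightarrow> 'b) \<Rightarrow> 'a \<Rightarrow> 'b"
  where "scaleR_fun c f = (\<lambda>x. c *\<^sub>R f x)"

instance
  by standard (simp_all add: scaleR_fun_def fun_eq_iff plus_fun_def algebra_simps)

end


section \<open>Quotients, direct sums and isomorphisms of real vector spaces\<close>

record 'v real_space =
  points :: "'v set"
  origin :: 'v
  plus_in :: "'v \<Rightarrow> 'v \<Rightarrow> 'v"
  scale_in :: "real \<Rightarrow> 'v \<Rightarrow> 'v"

definition real_line :: "real real_space" where
  "real_line = \<lparr>points = UNIV, origin = 0, plus_in = (+), scale_in = (*)\<rparr>"

text \<open>
  The quotient \<open>A/B\<close>, for subspaces \<open>B \<subseteq> A\<close>, consists of cosets. The summand \<open>B\<close> in the scalar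
  multiplication matters only for \<open>c = 0\<close>, where the plain image of a coset is \<open>{0}\<close> and not \<open>B\<close>.
\<close>

definition quotient_space :: "'v::real_vector set \<Rightarrow> 'v set \<Rightarrow> 'v set real_space" where
  "quotient_space A B =
     \<lparr>points = (\<lambda>x. x +o B) ` A, origin = B, plus_in = (+),
      scale_in = (\<lambda>c X. (\<lambda>x. c *\<^sub>R x) ` X + B)\<rparr>"

definition space_sum :: "'v real_space \<Rightarrow> 'w real_space \<Rightarrow> ('v \<times> 'w) real_space" where
  "space_sum V W =
     \<lparr>points = points V \<times> points W, origin = (origin V, origin W),
      plus_in = (\<lambda>x y. (plus_in V (fst x) (fst y), plus_in W (snd x) (snd y))),
      scale_in = (\<lambda>c x. (scale_in V c (fst x), scale_in W c (snd x)))\<rparr>"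

definition zero_space :: "'v real_space \<Rightarrow> bool" where
  "zero_space V \<longleftrightarrow> points V = {origin V}"

definition isomorphic_spaces :: "'v real_space \<Rightarrow> 'w real_space \<Rightarrow> bool" where
  "isomorphic_spaces V W \<longleftrightarrow>
     (\<exists>f. bij_betw f (points V) (points W) \<and>
          (\<forall>x\<in>points V. \<forall>y\<in>points V. f (plus_in V x y) = plus_in W (f x) (f y)) \<and>
          (\<forall>c. \<forall>x\<in>points V. f (scale_in V c x) = scale_in W c (f x)))"


section \<open>Lie algebras\<close>

text \<open>
  A Lie algebra is a nonzero finite dimensional subspace \<open>L\<close> of an ambient real vector space, with
  a bracket that is only relevant on \<open>L\<close>. An ideal is a Lie algebra with the same bracket.
\<close>

locale lie_algebra =
  fixes L :: "'a::real_vector set" and br :: "'a \<Rightarrow> 'a \<Rightarrow> 'a"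
  assumes subspace_L: "subspace L"
    and finite_dim: "\<exists>B. finite B \<and> span B = L"
    and nonzero: "L \<noteq> {0}"
    and br_closed: "x \<in> L \<Longrightarrow> y \<in> L \<Longrightarrow> br x y \<in> L"
    and br_add_left: "x \<in> L \<Longrightarrow> y \<in> L \<Longrightarrow> z \<in> L \<Longrightarrow> br (x + y) z = br x z + br y z"
    and br_add_right: "x \<in> L \<Longrightarrow> y \<in> L \<Longrightarrow> z \<in> L \<Longrightarrow> br x (y + z) = br x y + br x z"
    and br_scale_left: "x \<in> L \<Longrightarrow> y \<in> L \<Longrightarrow> br (c *\<^sub>R x) y = c *\<^sub>R br x y"
    and br_scale_right: "x \<in> L \<Longrightarrow> y \<in> L \<Longrightarrow> br x (c *\<^sub>R y) = c *\<^sub>R br x y"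
    and br_self: "x \<in> L \<Longrightarrow> br x x = 0"
    and jacobi: "x \<in> L \<Longrightarrow> y \<in> L \<Longrightarrow> z \<in> L \<Longrightarrow>
      br x (br y z) + br y (br z x) + br z (br x y) = 0"

definition lie_ideal :: "'a::real_vector set \<Rightarrow> ('a \<Rightarrow> 'a \<Rightarrow> 'a) \<Rightarrow> 'a set \<Rightarrow> bool" where
  "lie_ideal L br I \<longleftrightarrow> subspace I \<and> I \<subseteq> L \<and> (\<forall>x\<in>L. \<forall>y\<in>I. br x y \<in> I)"

fun central_series :: "'a::real_vector set \<Rightarrow> ('a \<Rightarrow> 'a \<Rightarrow> 'a) \<Rightarrow> nat \<Rightarrow> 'a set" where
  "central_series L br 0 = L"
| "central_series L br (Suc i) = span {br x y |x y. x \<in> L \<and> y \<in> central_series L br i}"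

definition step_nilpotent :: "nat \<Rightarrow> 'a::real_vector set \<Rightarrow> ('a \<Rightarrow> 'a \<Rightarrow> 'a) \<Rightarrow> bool" where
  "step_nilpotent k L br \<longleftrightarrow>
     k \<ge> 1 \<and> central_series L br k = {0} \<and> central_series L br (k - 1) \<noteq> {0}"

definition nil_index :: "'a::real_vector set \<Rightarrow> ('a \<Rightarrow> 'a \<Rightarrow> 'a) \<Rightarrow> nat" where
  "nil_index L br = (THE k. step_nilpotent k L br)"


section \<open>The Chevalley--Eilenberg complex\<close>

definition dual_space :: "'a::real_vector set \<Rightarrow> ('a \<Rightarrow> real) set" where
  "dual_space L =
     {f. (\<forall>x\<in>L. \<forall>y\<in>L. f (x + y) = f x + f y) \<and> (\<forall>c. \<forall>x\<in>L. f (c *\<^sub>R x) = c * f x) \<and>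
         (\<forall>x. x \<notin> L \<longrightarrow> f x = 0)}"

text \<open>
  A \<open>q\<close>-form on \<open>L\<close> is a function of the list of its arguments that vanishes on every list other
  than those of length \<open>q\<close> with entries in \<open>L\<close>. The wedge product of \<open>w\<^sub>0, \<dots>, w\<^sub>q\<^sub>-\<^sub>1\<close> is the
  alternating form \<open>det (w\<^sub>i(u\<^sub>j))\<close>; the wedge of a single functional is the functional itself,
  viewed as a 1-form.
\<close>

definition wedge :: "'a::real_vector set \<Rightarrow> ('a \<Rightarrow> real) list \<Rightarrow> 'a list \<Rightarrow> real" where
  "wedge L ws us =
     (if length us = length ws \<and> set us \<subseteq> L
      then det (mat (length ws) (length ws) (\<lambda>(i, j). (ws ! i) (us ! j))) else 0)"

text \<open>
  \<open>\<Lambda>\<^sup>q W\<close> for a subspace \<open>W\<close> of the dual of \<open>L\<close>, as a subspace of the alternating \<open>q\<close>-forms on \<open>L\<close>.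
\<close>

definition ext_power ::
  "'a::real_vector set \<Rightarrow> nat \<Rightarrow> ('a \<Rightarrow> real) set \<Rightarrow> ('a list \<Rightarrow> real) set" where
  "ext_power L q W = span {wedge L ws |ws. length ws = q \<and> set ws \<subseteq> W}"

text \<open>
  List positions start at 0, so the sign \<open>(-1)\<close> to the power \<open>i + j - 1\<close> for 1-based positions
  becomes \<open>(-1)\<close> to the power \<open>i + j + 1\<close>. Applied to an \<open>s\<close>-form, the result vanishes on lists
  whose length is not \<open>s + 1\<close>, and for \<open>s = 0\<close> it is \<open>0\<close>.
\<close>

definition ce_diff ::
  "'a::real_vector set \<Rightarrow> ('a \<Rightarrow> 'a \<Rightarrow> 'a) \<Rightarrow> ('a list \<Rightarrow> real) \<Rightarrow> 'a list \<Rightarrow> real" where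
  "ce_diff L br x us =
     (if set us \<subseteq> L
      then \<Sum>j<length us. \<Sum>i<j. (-1) ^ (i + j + 1) * x (br (us ! i) (us ! j) # nths us (- {i, j}))
      else 0)"

fun char_space :: "'a::real_vector set \<Rightarrow> ('a \<Rightarrow> 'a \<Rightarrow> 'a) \<Rightarrow> nat \<Rightarrow> ('a \<Rightarrow> real) set" where
  "char_space L br 0 = {0}"
| "char_space L br (Suc i) =
     {x \<in> dual_space L. ce_diff L br (wedge L [x]) \<in> ext_power L 2 (char_space L br i)}"


section \<open>The spectral sequence\<close>

text \<open>\<open>filtration L br p m\<close> is \<open>F\<^sup>p C\<^sup>m\<close>, with \<open>C\<^sup>m = 0\<close> for \<open>m < 0\<close>.\<close>

definition filtration ::
  "'a::real_vector set \<Rightarrow> ('a \<Rightarrow> 'a \<Rightarrow> 'a) \<Rightarrow> int \<Rightarrow> int \<Rightarrow> ('a list \<Rightarrow> real) set" where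
  "filtration L br p m =
     (if m < 0 \<or> p \<ge> int (nil_index L br) then {0}
      else ext_power L (nat m) (char_space L br (nat (int (nil_index L br) - p))))"

text \<open>The index \<open>r\<close> is an integer since \<open>E\<^sub>0\<close> involves \<open>r = -1\<close>.\<close>

definition approx_cycles ::
  "'a::real_vector set \<Rightarrow> ('a \<Rightarrow> 'a \<Rightarrow> 'a) \<Rightarrow> int \<Rightarrow> int \<Rightarrow> int \<Rightarrow> ('a list \<Rightarrow> real) set" where
  "approx_cycles L br r p q =
     {x \<in> filtration L br p (p + q). ce_diff L br x \<in> filtration L br (p + r) (p + q + 1)}"

definition spectral_page ::
  "'a::real_vector set \<Rightarrow> ('a \<Rightarrow> 'a \<Rightarrow> 'a) \<Rightarrow> nat \<Rightarrow> int \<Rightarrow> int \<Rightarrow> ('a list \<Rightarrow> real) set real_space" where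
  "spectral_page L br r p q =
     quotient_space (approx_cycles L br (int r) p q)
       (ce_diff L br ` approx_cycles L br (int r - 1) (p - int r + 1) (q + int r - 2)
        + approx_cycles L br (int r - 1) (p + 1) (q - 1))"

end

theory Submission
  imports Defs
begin

text \<open>
  For all \<open>r\<close>, \<open>p\<close>, \<open>q\<close> without restriction, the page \<open>E(p, q)\<close> of \<open>n\<close> is isomorphic to the direct sum of
  the pages \<open>E(p, q)\<close> and \<open>E(p, q - 1)\<close> of \<open>h\<close>; everything else is a computation in total degrees 0
  and 1.

  Let \<open>e\<close> span the line. It is central, because \<open>[e, h]\<close> lies in the intersection of the two ideals.
  Send a form \<open>w\<close> on \<open>n\<close> to the pair (\<open>w\<close> restricted to \<open>h\<close>, \<open>w(e, \<dots>)\<close> restricted to \<open>h\<close>). By Cartan's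
  formula and since \<open>e\<close> is central, this commutes with \<open>d\<close> up to a sign in the second component. It
  is injective on alternating forms (\<open>eq_0_if_components_0\<close>), and it maps each \<open>F\<^sup>pC\<^sup>m\<close> of \<open>n\<close> onto
  \<open>F\<^sup>pC\<^sup>m \<times> F\<^sup>pC\<^sup>m\<^sup>-\<^sup>1\<close> of \<open>h\<close>, because \<open>V\<^sub>i\<close> of \<open>n\<close> is spanned by the pullback of \<open>V\<^sub>i\<close> of \<open>h\<close> along the
  projection and, for \<open>i \<ge> 1\<close>, the closed functional dual to \<open>e\<close>. Consequently an alternating form on \<open>n\<close>
  belongs to a step of the filtration, to the approximate cycles or to the denominator of a page
  exactly when its two components do (\<open>filtration_iff\<close>, \<open>approx_cycles_iff\<close>, \<open>boundaries_iff\<close>), and the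
  isomorphism of the pages follows (\<open>page_splitting\<close>).
  That \<open>d\<close> preserves alternating forms is needed to apply injectivity to \<open>dw\<close>.

  In degree 0 the complex is \<open>\<real>\<close> with \<open>d = 0\<close>, and the filtration jumps only from \<open>p = k - 1\<close> to \<open>p = k\<close>;
  this gives one copy of \<open>\<real>\<close> at \<open>p = k - 1\<close>. In degree 1, the page vanishes for \<open>p < 0\<close> because
  \<open>V\<^sub>i\<close> is the whole dual for \<open>i \<ge> k\<close>: \<open>V\<^sub>i\<close> contains the annihilator of the \<open>i\<close>-th
  term of the central descending series (\<open>annihilator_subset_char_space\<close>).
\<close>

lemma scaleR_fun_apply [simp]: "(c *\<^sub>R f) x = c *\<^sub>R f x"
  by (simp add: scaleR_fun_def)

lemma sum_fun_apply: "(\<Sum>i\<in>A. f i) x = (\<Sum>i\<in>A. f i x)"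
  by (induction A rule: infinite_finite_induct) simp_all

section \<open>Alternating multilinear forms\<close>

text \<open>
  The degree is left out: forms of all degrees, and sums of such forms, are treated together, and
  contraction lowers the degree without a case distinction at degree 0.
\<close>

definition alternating :: "'a::real_vector set \<Rightarrow> ('a list \<Rightarrow> real) set" where
  "alternating L = {w.
     (\<forall>us. \<not> set us \<subseteq> L \<longrightarrow> w us = 0) \<and>
     (\<forall>xs ys. \<forall>x\<in>L. \<forall>y\<in>L. w (xs @ (x + y) # ys) = w (xs @ x # ys) + w (xs @ y # ys)) \<and>
     (\<forall>xs ys c. \<forall>x\<in>L. w (xs @ (c *\<^sub>R x) # ys) = c * w (xs @ x # ys)) \<and>
     (\<forall>xs ys x. w (xs @ x # x # ys) = 0)}"

definition contract :: "'a \<Rightarrow> ('a list \<Rightarrow> real) \<Rightarrow> 'a list \<Rightarrow> real" where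
  "contract u w = (\<lambda>us. w (u # us))"

lemma contract_apply [simp]: "contract u w us = w (u # us)"
  by (simp add: contract_def)

lemma contract_linear [simp]:
  "contract u (w + w') = contract u w + contract u w'"
  "contract u (w - w') = contract u w - contract u w'"
  "contract u (- w) = - contract u w"
  "contract u (c *\<^sub>R w) = c *\<^sub>R contract u w"
  "contract u 0 = 0"
  by (simp_all add: fun_eq_iff scaleR_fun_apply)

lemma subspace_alternating: "subspace (alternating L)"
  unfolding subspace_def alternating_def
  by (auto simp: scaleR_fun_apply algebra_simps)

lemma alternating_outside: "w \<in> alternating L \<Longrightarrow> \<not> set us \<subseteq> L \<Longrightarrow> w us = 0"
  by (simp add: alternating_def)

lemma alternating_add:
  "w \<in> alternating L \<Longrightarrow> x \<in> L \<Longrightarrow> y \<in> L \<Longrightarrow>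
    w (xs @ (x + y) # ys) = w (xs @ x # ys) + w (xs @ y # ys)"
  by (simp add: alternating_def)

lemma alternating_scale:
  "w \<in> alternating L \<Longrightarrow> x \<in> L \<Longrightarrow> w (xs @ (c *\<^sub>R x) # ys) = c * w (xs @ x # ys)"
  by (simp add: alternating_def)

lemma alternating_repeat: "w \<in> alternating L \<Longrightarrow> w (xs @ x # x # ys) = 0"
  by (simp add: alternating_def)

lemmas alternating_head_simps =
  alternating_add[where xs = "[]", simplified] alternating_scale[where xs = "[]", simplified]
  alternating_repeat[where xs = "[]", simplified]

lemma alternating_zero:
  assumes "w \<in> alternating L" "0 \<in> L"
  shows "w (xs @ 0 # ys) = 0"
  using alternating_scale[OF assms, of xs 0 ys] by simp

lemma contract_alternating:
  assumes w: "w \<in> alternating L"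
  shows "contract u w \<in> alternating L"
proof -
  have "w (u # xs @ (x + y) # ys) = w (u # xs @ x # ys) + w (u # xs @ y # ys)"
    if "x \<in> L" "y \<in> L" for xs ys x y
    using alternating_add[OF w that, of "u # xs"] by simp
  moreover have "w (u # xs @ (c *\<^sub>R x) # ys) = c * w (u # xs @ x # ys)" if "x \<in> L" for xs ys c x
    using alternating_scale[OF w that, of "u # xs"] by simp
  moreover have "w (u # xs @ x # x # ys) = 0" for xs ys x
    using alternating_repeat[OF w, of "u # xs"] by simp
  ultimately show ?thesis
    using alternating_outside[OF w] by (simp add: alternating_def)
qed

lemma alternating_swap:
  assumes w: "w \<in> alternating L" and L: "subspace L"
  shows "w (x # y # us) = - w (y # x # us)"
proof (cases "x \<in> L \<and> y \<in> L")
  case True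
  then have xy: "x \<in> L" "y \<in> L" "x + y \<in> L"
    using L by (auto simp: subspace_def)
  have "0 = w ((x + y) # (x + y) # us)"
    using alternating_head_simps(3)[OF w] by simp
  also have "\<dots> = w (x # (x + y) # us) + w (y # (x + y) # us)"
    using alternating_head_simps(1)[OF w] xy by simp
  also have "\<dots> = w (x # y # us) + w (y # x # us)"
    using alternating_add[OF w xy(1,2), of "[x]" us] alternating_add[OF w xy(1,2), of "[y]" us]
      alternating_head_simps(3)[OF w]
    by simp
  finally show ?thesis by simp
next
  case False
  then show ?thesis using alternating_outside[OF w] by auto
qed

lemma contract_zero: "w \<in> alternating L \<Longrightarrow> 0 \<in> L \<Longrightarrow> contract 0 w = 0"
  using alternating_zero[where xs = "[]"] by (fastforce simp: fun_eq_iff)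

lemma contract_add:
  "w \<in> alternating L \<Longrightarrow> x \<in> L \<Longrightarrow> y \<in> L \<Longrightarrow> contract (x + y) w = contract x w + contract y w"
  by (simp add: fun_eq_iff alternating_head_simps)

lemma contract_scale:
  "w \<in> alternating L \<Longrightarrow> x \<in> L \<Longrightarrow> contract (c *\<^sub>R x) w = c *\<^sub>R contract x w"
  by (simp add: fun_eq_iff alternating_head_simps scaleR_fun_apply)

lemma contract_twice: "w \<in> alternating L \<Longrightarrow> contract x (contract x w) = 0"
  by (simp add: fun_eq_iff alternating_head_simps)

text \<open>
  Multilinearity and alternation concern an arbitrary position of the argument list. For a family of
  forms closed under contraction it is enough to look at the head of the list, since contracting
  by the preceding arguments moves any position to the front.
\<close>

lemma alternating_coinduct:
  assumes S: "w \<in> S"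
    and outside: "\<And>w us. w \<in> S \<Longrightarrow> \<not> set us \<subseteq> L \<Longrightarrow> w us = 0"
    and add: "\<And>w x y. w \<in> S \<Longrightarrow> x \<in> L \<Longrightarrow> y \<in> L \<Longrightarrow> contract (x + y) w = contract x w + contract y w"
    and scale: "\<And>w x c. w \<in> S \<Longrightarrow> x \<in> L \<Longrightarrow> contract (c *\<^sub>R x) w = c *\<^sub>R contract x w"
    and twice: "\<And>w x. w \<in> S \<Longrightarrow> x \<in> L \<Longrightarrow> contract x (contract x w) = 0"
    and closed: "\<And>w x. w \<in> S \<Longrightarrow> x \<in> L \<Longrightarrow> contract x w \<in> S"
    and L: "subspace L"
  shows "w \<in> alternating L"
proof -
  have 1: "w (xs @ (x + y) # ys) = w (xs @ x # ys) + w (xs @ y # ys)"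
    if "x \<in> L" "y \<in> L" "w \<in> S" for w xs ys x y
    using that(3)
  proof (induction xs arbitrary: w)
    case Nil
    then show ?case using add[OF Nil that(1,2)] by (simp add: fun_eq_iff)
  next
    case (Cons z xs)
    then show ?case
      using Cons.IH[OF closed[OF Cons.prems], of z] outside[OF Cons.prems] by (cases "z \<in> L") auto
  qed
  have 2: "w (xs @ (c *\<^sub>R x) # ys) = c * w (xs @ x # ys)" if "x \<in> L" "w \<in> S" for w xs ys x c
    using that(2)
  proof (induction xs arbitrary: w)
    case Nil
    then show ?case using scale[OF Nil that(1)] by (simp add: fun_eq_iff scaleR_fun_apply)
  next
    case (Cons z xs)
    then show ?case
      using Cons.IH[OF closed[OF Cons.prems], of z] outside[OF Cons.prems] by (cases "z \<in> L") auto
  qed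
  have 3: "w (xs @ x # x # ys) = 0" if "w \<in> S" for w xs ys x
    using that
  proof (induction xs arbitrary: w)
    case Nil
    then show ?case
      using twice[OF Nil, of x] outside[OF Nil, of "x # x # ys"] by (cases "x \<in> L") (auto simp: fun_eq_iff)
  next
    case (Cons z xs)
    then show ?case
      using Cons.IH[OF closed[OF Cons.prems], of z] outside[OF Cons.prems] by (cases "z \<in> L") auto
  qed
  show ?thesis
    using S outside 1 2 3 by (simp add: alternating_def)
qed

section \<open>Wedge products are alternating\<close>

lemma nth_delete:
  assumes "i < length xs" "k < length xs - 1"
  shows "(take i xs @ drop (Suc i) xs) ! k = xs ! insert_index i k"
  using assms by (auto simp: nth_append insert_index_def min_def)

text \<open>
  Laplace expansion of the determinant along its first column.
\<close>

lemma contract_wedge: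
  assumes u: "u \<in> L"
  shows "contract u (wedge L ws) =
    (\<Sum>i<length ws. ((-1) ^ i * (ws ! i) u) *\<^sub>R wedge L (take i ws @ drop (Suc i) ws))"
proof
  fix us
  let ?n = "length ws"
  let ?del = "\<lambda>i. take i ws @ drop (Suc i) ws"
  have eval: "(\<Sum>i<?n. ((-1) ^ i * (ws ! i) u) *\<^sub>R wedge L (?del i)) us =
      (\<Sum>i<?n. ((-1) ^ i * (ws ! i) u) * wedge L (?del i) us)"
    by (simp add: sum_fun_apply)
  show "contract u (wedge L ws) us =
    (\<Sum>i<?n. ((-1) ^ i * (ws ! i) u) *\<^sub>R wedge L (?del i)) us"
  proof (cases "Suc (length us) = ?n \<and> set us \<subseteq> L")
    case True
    let ?A = "mat ?n ?n (\<lambda>(i, j). (ws ! i) ((u # us) ! j))"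
    have "contract u (wedge L ws) us = det ?A"
      using True u by (simp add: wedge_def)
    also have "\<dots> = (\<Sum>i<?n. ?A $$ (i, 0) * cofactor ?A i 0)"
      using True by (intro laplace_expansion_column) auto
    also have "\<dots> = (\<Sum>i<?n. ((-1) ^ i * (ws ! i) u) * wedge L (?del i) us)"
    proof (rule sum.cong[OF refl])
      fix i assume "i \<in> {..<?n}"
      then have i: "i < ?n" by simp
      have len: "length (?del i) = ?n - 1" "length us = ?n - 1"
        using i True by auto
      have A0: "?A $$ (i, 0) = (ws ! i) u"
        using i by (subst index_mat) auto
      have "mat_delete ?A i 0 = mat (?n - 1) (?n - 1) (\<lambda>(i', j). (?del i ! i') (us ! j))"
        using i len by (intro eq_matI) (auto simp: mat_delete_def nth_delete insert_index_def)
      then show "?A $$ (i, 0) * cofactor ?A i 0 = ((-1) ^ i * (ws ! i) u) * wedge L (?del i) us"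
        using i len True A0 by (simp add: cofactor_def wedge_def)
    qed
    finally show ?thesis using eval by simp
  next
    case False
    have "wedge L (?del i) us = 0" if "i < ?n" for i
      using False that by (auto simp: wedge_def)
    moreover have "contract u (wedge L ws) us = 0"
      using False by (auto simp: wedge_def)
    ultimately show ?thesis unfolding eval by simp
  qed
qed

lemma wedge_repeat_head: "wedge L ws (x # x # us) = 0"
proof (cases "length ws = Suc (Suc (length us))")
  case True
  let ?A = "mat (length ws) (length ws) (\<lambda>(i, j). (ws ! i) ((x # x # us) ! j))"
  have "det ?A = 0"
    by (rule det_identical_columns[of _ "length ws" 0 1])
      (use True in \<open>auto simp: col_def intro!: eq_vecI\<close>)
  then show ?thesis by (simp add: wedge_def)
qed (auto simp: wedge_def)

lemma dual_space_add: "f \<in> dual_space L \<Longrightarrow> x \<in> L \<Longrightarrow> y \<in> L \<Longrightarrow> f (x + y) = f x + f y"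
  by (simp add: dual_space_def)

lemma dual_space_scale: "f \<in> dual_space L \<Longrightarrow> x \<in> L \<Longrightarrow> f (c *\<^sub>R x) = c * f x"
  by (simp add: dual_space_def)

lemma subspace_dual_space: "subspace (dual_space L)"
  unfolding subspace_def dual_space_def by (auto simp: scaleR_fun_apply algebra_simps)

text \<open>
  The span of all wedge products is closed under contraction by the expansion above, so only the
  first arguments of a wedge product have to be examined.
\<close>

lemma wedge_alternating:
  assumes L: "subspace L" and ws: "set ws \<subseteq> dual_space L"
  shows "wedge L ws \<in> alternating L"
proof -
  define S where "S = span {wedge L ws |ws. set ws \<subseteq> dual_space L}"
  define P where "P = {w. (\<forall>us. \<not> set us \<subseteq> L \<longrightarrow> w us = 0) \<and>
    (\<forall>x\<in>L. \<forall>y\<in>L. contract (x + y) w = contract x w + contract y w) \<and>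
    (\<forall>c. \<forall>x\<in>L. contract (c *\<^sub>R x) w = c *\<^sub>R contract x w) \<and>
    (\<forall>x. contract x (contract x w) = 0) \<and> (\<forall>x\<in>L. contract x w \<in> S)}"
  have "subspace P"
    unfolding subspace_def P_def S_def
    by (auto simp: scaleR_fun_apply algebra_simps span_add span_scale span_zero)
  moreover have "wedge L ws \<in> P" if ws: "set ws \<subseteq> dual_space L" for ws
  proof -
    have dual: "ws ! i \<in> dual_space L" if "i < length ws" for i
      using ws that by auto
    have L_add: "x + y \<in> L" and L_scale: "c *\<^sub>R x \<in> L" if "x \<in> L" "y \<in> L" for x y c
      using L that by (auto simp: subspace_def)
    have "contract (x + y) (wedge L ws) = contract x (wedge L ws) + contract y (wedge L ws)"
      if "x \<in> L" "y \<in> L" for x y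
      unfolding contract_wedge[OF that(1)] contract_wedge[OF that(2)] contract_wedge[OF L_add[OF that]]
        sum.distrib[symmetric]
      by (intro sum.cong) (simp_all add: dual_space_add[OF dual that] algebra_simps)
    moreover have "contract (c *\<^sub>R x) (wedge L ws) = c *\<^sub>R contract x (wedge L ws)"
      if "x \<in> L" for x c
      unfolding contract_wedge[OF that] contract_wedge[OF L_scale[OF that that]] scaleR_sum_right
      by (intro sum.cong) (simp_all add: dual_space_scale[OF dual that])
    moreover have "contract x (wedge L ws) \<in> S" if "x \<in> L" for x
      unfolding contract_wedge[OF that]
    proof (rule subspace_sum)
      fix i
      have "set (take i ws @ drop (Suc i) ws) \<subseteq> dual_space L"
        using ws set_take_subset[of i ws] set_drop_subset[of "Suc i" ws] by auto
      then have "wedge L (take i ws @ drop (Suc i) ws) \<in> S"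
        unfolding S_def by (intro span_base) blast
      then show "((-1) ^ i * (ws ! i) x) *\<^sub>R wedge L (take i ws @ drop (Suc i) ws) \<in> S"
        unfolding S_def by (rule span_scale)
    qed (simp add: S_def)
    moreover have "contract x (contract x (wedge L ws)) = 0" for x
      by (simp add: fun_eq_iff wedge_repeat_head)
    ultimately show ?thesis
      by (simp add: P_def wedge_def)
  qed
  ultimately have SP: "S \<subseteq> P"
    unfolding S_def by (intro span_minimal) auto
  show ?thesis
  proof (rule alternating_coinduct[of _ S])
    show "wedge L ws \<in> S"
      unfolding S_def using ws by (intro span_base) auto
  qed (use SP L in \<open>unfold P_def; blast\<close>)+
qed

lemma subspace_ext_power: "subspace (ext_power L q W)"
  by (simp add: ext_power_def)

lemma ext_power_alternating:
  assumes L: "subspace L" and W: "W \<subseteq> dual_space L" and w: "w \<in> ext_power L q W"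
  shows "w \<in> alternating L"
proof -
  have "ext_power L q W \<subseteq> alternating L"
    unfolding ext_power_def
    using wedge_alternating[OF L] W by (intro span_minimal subspace_alternating) auto
  with w show ?thesis by auto
qed

section \<open>Cartan's formula for the Chevalley--Eilenberg differential\<close>

text \<open>
  The sign is opposite to the usual one, in accordance with the convention \<open>df(u, v) = f([u, v])\<close> for
  the differential of a functional.
\<close>

definition lie_derivative ::
  "'a::real_vector set \<Rightarrow> ('a \<Rightarrow> 'a \<Rightarrow> 'a) \<Rightarrow> 'a \<Rightarrow> ('a list \<Rightarrow> real) \<Rightarrow> 'a list \<Rightarrow> real" where
  "lie_derivative L br u w us =
     (if set us \<subseteq> L then \<Sum>j<length us. w (us[j := br u (us ! j)]) else 0)"

lemma ce_diff_linear [simp]: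
  "ce_diff L br (w + w') = ce_diff L br w + ce_diff L br w'"
  "ce_diff L br (w - w') = ce_diff L br w - ce_diff L br w'"
  "ce_diff L br (- w) = - ce_diff L br w"
  "ce_diff L br (c *\<^sub>R w) = c *\<^sub>R ce_diff L br w"
  "ce_diff L br 0 = 0"
  by (simp_all add: fun_eq_iff ce_diff_def algebra_simps sum.distrib sum_subtractf sum_negf
      sum_distrib_left)

lemma linear_ce_diff: "linear (ce_diff L br)"
  by (rule linearI) simp_all

lemma lie_derivative_linear [simp]:
  "lie_derivative L br u (w + w') = lie_derivative L br u w + lie_derivative L br u w'"
  "lie_derivative L br u (w - w') = lie_derivative L br u w - lie_derivative L br u w'"
  "lie_derivative L br u (- w) = - lie_derivative L br u w"
  "lie_derivative L br u (c *\<^sub>R w) = c *\<^sub>R lie_derivative L br u w"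
  "lie_derivative L br u 0 = 0"
  by (simp_all add: fun_eq_iff lie_derivative_def algebra_simps sum.distrib sum_subtractf sum_negf
      sum_distrib_left)

lemma contract_lie_derivative:
  assumes "w \<in> alternating L" "v \<in> L"
  shows "contract v (lie_derivative L br u w) =
    contract (br u v) w + lie_derivative L br u (contract v w)"
proof
  fix vs
  show "contract v (lie_derivative L br u w) vs =
    (contract (br u v) w + lie_derivative L br u (contract v w)) vs"
    using assms alternating_outside[OF assms(1), of "br u v # vs"]
    by (simp add: lie_derivative_def sum.lessThan_Suc_shift del: sum.lessThan_Suc)
qed

lemma lie_derivative_Nil [simp]: "lie_derivative L br u w [] = 0"
  by (simp add: lie_derivative_def)

text \<open>
  The left-hand side collects the terms of \<open>dw(u, us)\<close> in which \<open>u\<close> enters the bracket. Moving the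
  bracket from the front to position \<open>j\<close> takes \<open>j\<close> transpositions, which cancels the sign.
\<close>

lemma signed_bracket_sum_eq_lie_derivative:
  assumes L: "subspace L" and w: "w \<in> alternating L" and us: "set us \<subseteq> L"
  shows "(\<Sum>j<length us. (-1) ^ j * w (br u (us ! j) # nths us (- {j}))) = lie_derivative L br u w us"
  using w us
proof (induction us arbitrary: w)
  case Nil
  then show ?case by simp
next
  case (Cons v vs)
  have nths: "nths (v # vs) (- {0}) = vs" "nths (v # vs) (- {Suc j}) = v # nths vs (- {j})" for j
  proof -
    have "{j. Suc j \<in> - {0}} = UNIV" by auto
    then show "nths (v # vs) (- {0}) = vs" by (simp add: nths_Cons nths_all)
    have "{i. Suc i \<in> - {Suc j}} = - {j}" by auto
    then show "nths (v # vs) (- {Suc j}) = v # nths vs (- {j})" by (simp add: nths_Cons)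
  qed
  have "(\<Sum>j<length (v # vs). (-1) ^ j * w (br u ((v # vs) ! j) # nths (v # vs) (- {j}))) =
    w (br u v # vs) + (\<Sum>j<length vs. - ((-1) ^ j * w (br u (vs ! j) # v # nths vs (- {j}))))"
    by (simp add: sum.lessThan_Suc_shift nths del: sum.lessThan_Suc)
  also have "(\<Sum>j<length vs. - ((-1) ^ j * w (br u (vs ! j) # v # nths vs (- {j})))) =
    (\<Sum>j<length vs. (-1) ^ j * contract v w (br u (vs ! j) # nths vs (- {j})))"
    by (rule sum.cong[OF refl]) (subst alternating_swap[OF Cons.prems(1) L], simp)
  also have "\<dots> = lie_derivative L br u (contract v w) vs"
    using Cons.prems by (intro Cons.IH contract_alternating) auto
  finally show ?case
    using fun_cong[OF contract_lie_derivative[OF Cons.prems(1), of v br u], of vs] Cons.prems by simp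
qed

text \<open>
  In the sum for \<open>dw(u, us)\<close> either \<open>u\<close> enters the bracket, or it becomes the second argument of \<open>w\<close>,
  and swapping it with the bracket turns the rest of the sum into that of the contraction by \<open>u\<close>.
\<close>

lemma cartan_formula:
  assumes L: "subspace L" and w: "w \<in> alternating L" and u: "u \<in> L"
  shows "contract u (ce_diff L br w) = lie_derivative L br u w - ce_diff L br (contract u w)"
proof
  fix us
  show "contract u (ce_diff L br w) us = (lie_derivative L br u w - ce_diff L br (contract u w)) us"
  proof (cases "set us \<subseteq> L")
    case True
    have "{k. Suc k \<in> - {0, Suc j}} = - {j}" for j by auto
    then have nths0: "nths (u # us) (- {0, Suc j}) = nths us (- {j})" for j
      by (simp add: nths_Cons)
    have "{k. Suc k \<in> - {Suc i, Suc j}} = - {i, j}" for i j by auto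
    then have nthsS: "nths (u # us) (- {Suc i, Suc j}) = u # nths us (- {i, j})" for i j
      by (simp add: nths_Cons)
    have "contract u (ce_diff L br w) us =
      (\<Sum>j<length us. \<Sum>i<Suc j. (-1) ^ (i + Suc j + 1) *
         w (br ((u # us) ! i) (us ! j) # nths (u # us) (- {i, Suc j})))"
      using True u
      by (simp add: ce_diff_def sum.lessThan_Suc_shift[of _ "length us"] del: sum.lessThan_Suc)
    also have "\<dots> = (\<Sum>j<length us. (-1) ^ j * w (br u (us ! j) # nths us (- {j})) +
        (\<Sum>i<j. - ((-1) ^ (i + j + 1) * w (u # br (us ! i) (us ! j) # nths us (- {i, j})))))"
    proof (rule sum.cong[OF refl])
      fix j
      have "(-1) ^ (Suc i + Suc j + 1) * w (br (us ! i) (us ! j) # u # nths us (- {i, j})) =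
        - ((-1) ^ (i + j + 1) * w (u # br (us ! i) (us ! j) # nths us (- {i, j})))" for i
        by (subst alternating_swap[OF w L]) simp
      then show "(\<Sum>i<Suc j. (-1) ^ (i + Suc j + 1) *
         w (br ((u # us) ! i) (us ! j) # nths (u # us) (- {i, Suc j}))) =
        (-1) ^ j * w (br u (us ! j) # nths us (- {j})) +
        (\<Sum>i<j. - ((-1) ^ (i + j + 1) * w (u # br (us ! i) (us ! j) # nths us (- {i, j}))))"
        by (simp only: sum.lessThan_Suc_shift nths0 nthsS nth_Cons_Suc nth_Cons_0) simp
    qed
    also have "\<dots> = (\<Sum>j<length us. (-1) ^ j * w (br u (us ! j) # nths us (- {j}))) -
        ce_diff L br (contract u w) us"
      using True by (simp add: ce_diff_def sum.distrib sum_negf)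
    also have "\<dots> = (lie_derivative L br u w - ce_diff L br (contract u w)) us"
      by (simp add: signed_bracket_sum_eq_lie_derivative[OF L w True])
    finally show ?thesis .
  qed (simp add: ce_diff_def lie_derivative_def)
qed

context lie_algebra
begin

lemma br_skew: "x \<in> L \<Longrightarrow> y \<in> L \<Longrightarrow> br x y = - br y x"
proof -
  assume xy: "x \<in> L" "y \<in> L"
  then have s: "x + y \<in> L" using subspace_L by (simp add: subspace_def)
  have "0 = br (x + y) (x + y)" using br_self[OF s] by simp
  also have "\<dots> = br x y + br y x"
    by (simp only: br_add_left[OF xy s] br_add_right[OF _ xy] xy br_self add_0_left add_0_right)
  finally show ?thesis by (simp add: eq_neg_iff_add_eq_0)
qed

lemma zero_in_L: "0 \<in> L"
  using subspace_L by (rule subspace_0)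

lemma br_zero_right: "x \<in> L \<Longrightarrow> br x 0 = 0"
  using br_scale_right[OF _ zero_in_L, of x 0] by simp

text \<open>
  Contracting a Lie derivative yields a Lie derivative plus an alternating form, so the family to
  which coinduction applies has to include these sums. The differential below is treated in the
  same way.
\<close>

lemma lie_derivative_alternating:
  assumes u: "u \<in> L" and w: "w \<in> alternating L"
  shows "lie_derivative L br u w \<in> alternating L"
proof -
  define S where "S = {lie_derivative L br u w + w' |w w'. w \<in> alternating L \<and> w' \<in> alternating L}"
  show ?thesis
  proof (rule alternating_coinduct[of _ S])
    show "lie_derivative L br u w \<in> S"
      unfolding S_def using w subspace_0[OF subspace_alternating, of L]
      by (intro CollectI exI[of _ w] exI[of _ 0]) simp
  next
    fix v us assume "v \<in> S" and us: "\<not> set us \<subseteq> L"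
    then obtain w w' where v: "v = lie_derivative L br u w + w'" and w': "w' \<in> alternating L"
      by (auto simp: S_def)
    have "w' us = 0" using w' us by (rule alternating_outside)
    then show "v us = 0" using us by (simp add: v lie_derivative_def)
  next
    fix v x y assume "v \<in> S" and xy: "x \<in> L" "y \<in> L"
    then obtain w w' where v: "v = lie_derivative L br u w + w'"
      and w: "w \<in> alternating L" "w' \<in> alternating L"
      by (auto simp: S_def)
    have "x + y \<in> L" using xy subspace_L by (simp add: subspace_def)
    then show "contract (x + y) v = contract x v + contract y v"
      using w xy u
      by (simp add: v contract_lie_derivative[OF w(1)] contract_add[of _ L] contract_alternating
          br_add_right br_closed)
  next
    fix v x and c :: real assume "v \<in> S" and x: "x \<in> L"
    then obtain w w' where v: "v = lie_derivative L br u w + w'"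
      and w: "w \<in> alternating L" "w' \<in> alternating L"
      by (auto simp: S_def)
    have "c *\<^sub>R x \<in> L" using x subspace_L by (simp add: subspace_def)
    then show "contract (c *\<^sub>R x) v = c *\<^sub>R contract x v"
      using w x u
      by (simp add: v contract_lie_derivative[OF w(1)] contract_scale[of _ L] contract_alternating
          br_scale_right br_closed scaleR_add_right)
  next
    fix v x assume "v \<in> S" and x: "x \<in> L"
    then obtain w w' where v: "v = lie_derivative L br u w + w'"
      and w: "w \<in> alternating L" "w' \<in> alternating L"
      by (auto simp: S_def)
    have "contract x (contract (br u x) w) + contract (br u x) (contract x w) = 0"
      by (simp add: fun_eq_iff alternating_swap[OF w(1) subspace_L, of x])
    then show "contract x (contract x v) = 0"
      using w x
      by (simp add: v contract_lie_derivative contract_alternating contract_twice algebra_simps)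
  next
    fix v x assume "v \<in> S" and x: "x \<in> L"
    then obtain w w' where v: "v = lie_derivative L br u w + w'"
      and w: "w \<in> alternating L" "w' \<in> alternating L"
      by (auto simp: S_def)
    have "contract x v = lie_derivative L br u (contract x w) + (contract (br u x) w + contract x w')"
      using w x by (simp add: v contract_lie_derivative)
    moreover have "contract (br u x) w + contract x w' \<in> alternating L"
      using w by (intro subspace_add subspace_alternating contract_alternating)
    ultimately show "contract x v \<in> S"
      using contract_alternating[OF w(1), of x] by (auto simp: S_def)
  qed (rule subspace_L)
qed

lemma lie_derivative_add:
  assumes "x \<in> L" "y \<in> L" and w: "w \<in> alternating L"
  shows "lie_derivative L br (x + y) w = lie_derivative L br x w + lie_derivative L br y w"
proof
  fix us
  have "w (us[j := br (x + y) (us ! j)]) = w (us[j := br x (us ! j)]) + w (us[j := br y (us ! j)])"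
    if "j < length us" "set us \<subseteq> L" for j
  proof -
    have "us ! j \<in> L" using that by auto
    then show ?thesis
      using assms that(1) by (simp add: br_add_left upd_conv_take_nth_drop alternating_add br_closed)
  qed
  then show "lie_derivative L br (x + y) w us = (lie_derivative L br x w + lie_derivative L br y w) us"
    by (simp add: lie_derivative_def sum.distrib)
qed

lemma lie_derivative_scale:
  assumes "x \<in> L" and w: "w \<in> alternating L"
  shows "lie_derivative L br (c *\<^sub>R x) w = c *\<^sub>R lie_derivative L br x w"
proof
  fix us
  have "w (us[j := br (c *\<^sub>R x) (us ! j)]) = c * w (us[j := br x (us ! j)])"
    if "j < length us" "set us \<subseteq> L" for j
  proof -
    have "us ! j \<in> L" using that by auto
    then show ?thesis
      using assms that(1) by (simp add: br_scale_left upd_conv_take_nth_drop alternating_scale br_closed)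
  qed
  then show "lie_derivative L br (c *\<^sub>R x) w us = (c *\<^sub>R lie_derivative L br x w) us"
    by (simp add: lie_derivative_def sum_distrib_left)
qed

text \<open>
  Every term of the sum has an argument \<open>0\<close>.
\<close>

lemma lie_derivative_central:
  assumes "\<And>x. x \<in> L \<Longrightarrow> br e x = 0" and w: "w \<in> alternating L"
  shows "lie_derivative L br e w = 0"
proof
  fix us
  have "w (us[j := br e (us ! j)]) = 0" if "j < length us" "set us \<subseteq> L" for j
  proof -
    have "us ! j \<in> L" using that by auto
    then show ?thesis
      using assms that(1) by (simp add: upd_conv_take_nth_drop alternating_zero[OF w zero_in_L])
  qed
  then show "lie_derivative L br e w us = 0 us"
    by (simp add: lie_derivative_def)
qed

lemma ce_diff_alternating:
  assumes w: "w \<in> alternating L"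
  shows "ce_diff L br w \<in> alternating L"
proof -
  define S where "S = {ce_diff L br w + w' |w w'. w \<in> alternating L \<and> w' \<in> alternating L}"
  note cartan = cartan_formula[OF subspace_L, of _ _ br]
  show ?thesis
  proof (rule alternating_coinduct[of _ S])
    show "ce_diff L br w \<in> S"
      unfolding S_def using w subspace_0[OF subspace_alternating, of L]
      by (intro CollectI exI[of _ w] exI[of _ 0]) simp
  next
    fix v us assume "v \<in> S" and us: "\<not> set us \<subseteq> L"
    then obtain w w' where v: "v = ce_diff L br w + w'" and w': "w' \<in> alternating L"
      by (auto simp: S_def)
    have "w' us = 0" using w' us by (rule alternating_outside)
    then show "v us = 0" using us by (simp add: v ce_diff_def)
  next
    fix v x y assume "v \<in> S" and xy: "x \<in> L" "y \<in> L"
    then obtain w w' where v: "v = ce_diff L br w + w'"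
      and w: "w \<in> alternating L" "w' \<in> alternating L"
      by (auto simp: S_def)
    have "x + y \<in> L" using xy subspace_L by (simp add: subspace_def)
    then show "contract (x + y) v = contract x v + contract y v"
      using w xy
      by (simp add: v cartan contract_add[of _ L] lie_derivative_add)
  next
    fix v x and c :: real assume "v \<in> S" and x: "x \<in> L"
    then obtain w w' where v: "v = ce_diff L br w + w'"
      and w: "w \<in> alternating L" "w' \<in> alternating L"
      by (auto simp: S_def)
    have "c *\<^sub>R x \<in> L" using x subspace_L by (simp add: subspace_def)
    then show "contract (c *\<^sub>R x) v = c *\<^sub>R contract x v"
      using w x
      by (simp add: v cartan contract_scale[of _ L] lie_derivative_scale algebra_simps)
  next
    fix v x assume "v \<in> S" and x: "x \<in> L"
    then obtain w w' where v: "v = ce_diff L br w + w'"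
      and w: "w \<in> alternating L" "w' \<in> alternating L"
      by (auto simp: S_def)
    show "contract x (contract x v) = 0"
      using w x
      by (simp add: v cartan contract_lie_derivative contract_alternating contract_twice[of _ L]
          br_self contract_zero zero_in_L)
  next
    fix v x assume "v \<in> S" and x: "x \<in> L"
    then obtain w w' where v: "v = ce_diff L br w + w'"
      and w: "w \<in> alternating L" "w' \<in> alternating L"
      by (auto simp: S_def)
    have "contract x v = ce_diff L br (- contract x w) + (lie_derivative L br x w + contract x w')"
      using w x by (simp add: v cartan)
    moreover have "lie_derivative L br x w + contract x w' \<in> alternating L"
      using w x by (intro subspace_add subspace_alternating contract_alternating lie_derivative_alternating)
    moreover have "- contract x w \<in> alternating L"
      using w by (intro subspace_neg subspace_alternating contract_alternating)
    ultimately show "contract x v \<in> S"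
      unfolding S_def by blast
  qed (rule subspace_L)
qed

end

section \<open>Pullback along Lie algebra homomorphisms\<close>

definition dual_map :: "('a \<Rightarrow> 'b) \<Rightarrow> 'a set \<Rightarrow> ('b \<Rightarrow> real) \<Rightarrow> 'a \<Rightarrow> real" where
  "dual_map \<phi> L f = (\<lambda>x. if x \<in> L then f (\<phi> x) else 0)"

definition pullback :: "('a \<Rightarrow> 'b) \<Rightarrow> 'a set \<Rightarrow> ('b list \<Rightarrow> real) \<Rightarrow> 'a list \<Rightarrow> real" where
  "pullback \<phi> L w = (\<lambda>us. if set us \<subseteq> L then w (map \<phi> us) else 0)"

lemma pullback_linear [simp]:
  "pullback \<phi> L (w + w') = pullback \<phi> L w + pullback \<phi> L w'"
  "pullback \<phi> L (w - w') = pullback \<phi> L w - pullback \<phi> L w'"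
  "pullback \<phi> L (- w) = - pullback \<phi> L w"
  "pullback \<phi> L (c *\<^sub>R w) = c *\<^sub>R pullback \<phi> L w"
  "pullback \<phi> L 0 = 0"
  by (simp_all add: fun_eq_iff pullback_def)

lemma linear_pullback: "linear (pullback \<phi> L)"
  by (rule linearI) simp_all

lemma pullback_wedge:
  assumes "\<phi> ` L \<subseteq> M"
  shows "pullback \<phi> L (wedge M ws) = wedge L (map (dual_map \<phi> L) ws)"
proof
  fix us
  have "mat (length ws) (length ws) (\<lambda>(i, j). (ws ! i) (map \<phi> us ! j)) =
    mat (length ws) (length ws) (\<lambda>(i, j). (map (dual_map \<phi> L) ws ! i) (us ! j))"
    if "length us = length ws" "set us \<subseteq> L"
  proof (rule eq_matI)
    fix i j
    assume "i < dim_row (mat (length ws) (length ws) (\<lambda>(i, j). (map (dual_map \<phi> L) ws ! i) (us ! j)))"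
      "j < dim_col (mat (length ws) (length ws) (\<lambda>(i, j). (map (dual_map \<phi> L) ws ! i) (us ! j)))"
    then have "i < length ws" "j < length ws" by auto
    moreover from this that have "us ! j \<in> L" by auto
    ultimately show "mat (length ws) (length ws) (\<lambda>(i, j). (ws ! i) (map \<phi> us ! j)) $$ (i, j) =
      mat (length ws) (length ws) (\<lambda>(i, j). (map (dual_map \<phi> L) ws ! i) (us ! j)) $$ (i, j)"
      using that by (simp add: dual_map_def)
  qed simp_all
  moreover have "\<phi> ` set us \<subseteq> M" if "set us \<subseteq> L"
    using assms that by auto
  ultimately show "pullback \<phi> L (wedge M ws) us = wedge L (map (dual_map \<phi> L) ws) us"
    by (auto simp: pullback_def wedge_def)
qed

lemma pullback_ext_power:
  assumes "\<phi> ` L \<subseteq> M" and "\<And>f. f \<in> W \<Longrightarrow> dual_map \<phi> L f \<in> W'" and w: "w \<in> ext_power M q W"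
  shows "pullback \<phi> L w \<in> ext_power L q W'"
  using w unfolding ext_power_def
proof (rule span_induct)
  show "subspace {w. pullback \<phi> L w \<in> span {wedge L ws |ws. length ws = q \<and> set ws \<subseteq> W'}}"
    using linear_subspace_vimage[OF linear_pullback subspace_span, of \<phi> L] by (simp add: vimage_def)
next
  fix v assume "v \<in> {wedge M ws |ws. length ws = q \<and> set ws \<subseteq> W}"
  then obtain ws where ws: "v = wedge M ws" "length ws = q" "set ws \<subseteq> W" by auto
  then show "pullback \<phi> L v \<in> span {wedge L ws |ws. length ws = q \<and> set ws \<subseteq> W'}"
    using pullback_wedge[OF assms(1), of ws] ws
    by (intro span_base CollectI exI[of _ "map (dual_map \<phi> L) ws"]) (auto intro: assms(2))
qed

lemma dual_map_dual_space:
  assumes "\<phi> ` L \<subseteq> M" "linear \<phi>" "f \<in> dual_space M" "subspace L"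
  shows "dual_map \<phi> L f \<in> dual_space L"
  using assms
  by (auto simp: dual_space_def dual_map_def subspace_def linear_add linear_scale image_subset_iff)

lemma char_space_subset_dual: "char_space L br i \<subseteq> dual_space L"
  using subspace_0[OF subspace_dual_space, of L] by (cases i) auto

locale lie_hom = source: lie_algebra L br + target: lie_algebra M br'
  for L :: "'a::real_vector set" and br and M :: "'b::real_vector set" and br' +
  fixes \<phi> :: "'a \<Rightarrow> 'b"
  assumes maps_into: "\<phi> ` L \<subseteq> M" and linear_phi: "linear \<phi>"
    and bracket: "x \<in> L \<Longrightarrow> y \<in> L \<Longrightarrow> \<phi> (br x y) = br' (\<phi> x) (\<phi> y)"
begin

lemma ce_diff_pullback: "ce_diff L br (pullback \<phi> L w) = pullback \<phi> L (ce_diff M br' w)"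
proof
  fix us
  show "ce_diff L br (pullback \<phi> L w) us = pullback \<phi> L (ce_diff M br' w) us"
  proof (cases "set us \<subseteq> L")
    case True
    then have "\<phi> ` set us \<subseteq> M" using maps_into by auto
    moreover have "pullback \<phi> L w (br (us ! i) (us ! j) # nths us (- {i, j})) =
        w (br' (map \<phi> us ! i) (map \<phi> us ! j) # nths (map \<phi> us) (- {i, j}))"
      if "j < length us" "i < j" for i j
    proof -
      have "us ! i \<in> L" "us ! j \<in> L" "i < length us" using True that by auto
      moreover have "set (nths us (- {i, j})) \<subseteq> L"
        using True set_nths_subset[of us] by blast
      ultimately show ?thesis
        using that by (simp add: pullback_def bracket source.br_closed nths_map)
    qed
    ultimately show ?thesis
      using True by (simp add: pullback_def[of _ _ "ce_diff M br' w"] ce_diff_def)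
  qed (simp add: pullback_def ce_diff_def)
qed

text \<open>
  The spaces \<open>V\<^sub>i\<close> are natural in the Lie algebra, because their definition only involves the
  differential and wedge products, with which pullback commutes. The inclusion of \<open>h\<close> and the
  projection onto \<open>h\<close> are both covered by this.
\<close>

lemma dual_map_char_space:
  "f \<in> char_space M br' i \<Longrightarrow> dual_map \<phi> L f \<in> char_space L br i"
proof (induction i arbitrary: f)
  case 0
  then show ?case by (simp add: dual_map_def fun_eq_iff)
next
  case (Suc i)
  then have f: "f \<in> dual_space M" "ce_diff M br' (wedge M [f]) \<in> ext_power M 2 (char_space M br' i)"
    by auto
  have "ce_diff L br (wedge L [dual_map \<phi> L f]) = pullback \<phi> L (ce_diff M br' (wedge M [f]))"
    using pullback_wedge[OF maps_into, of "[f]"] by (simp flip: ce_diff_pullback)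
  also have "\<dots> \<in> ext_power L 2 (char_space L br i)"
    by (rule pullback_ext_power[OF maps_into Suc.IH f(2)])
  finally show ?case
    using dual_map_dual_space[OF maps_into linear_phi f(1) source.subspace_L] by simp
qed

lemma pullback_filtration:
  assumes "nil_index L br = nil_index M br'" and w: "w \<in> filtration M br' p m"
  shows "pullback \<phi> L w \<in> filtration L br p m"
proof -
  have "pullback \<phi> L w \<in> ext_power L a (char_space L br b)"
    if "w \<in> ext_power M a (char_space M br' b)" for a b
    by (rule pullback_ext_power[OF maps_into dual_map_char_space that])
  then show ?thesis
    using w by (auto simp: filtration_def assms(1) split: if_splits)
qed

end

section \<open>Numerators and denominators of the pages\<close>

lemma subspace_filtration: "subspace (filtration L br p m)"
  by (simp add: filtration_def subspace_ext_power)

lemma subspace_approx_cycles: "subspace (approx_cycles L br r p q)"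
proof -
  have "approx_cycles L br r p q =
    filtration L br p (p + q) \<inter> ce_diff L br -` filtration L br (p + r) (p + q + 1)"
    by (auto simp: approx_cycles_def)
  then show ?thesis
    by (simp add: subspace_inter subspace_filtration linear_subspace_vimage[OF linear_ce_diff])
qed

definition boundaries ::
  "'a::real_vector set \<Rightarrow> ('a \<Rightarrow> 'a \<Rightarrow> 'a) \<Rightarrow> int \<Rightarrow> int \<Rightarrow> int \<Rightarrow> ('a list \<Rightarrow> real) set" where
  "boundaries L br r p q =
     ce_diff L br ` approx_cycles L br (r - 1) (p - r + 1) (q + r - 2)
       + approx_cycles L br (r - 1) (p + 1) (q - 1)"

lemma spectral_page_eq:
  "spectral_page L br r p q = quotient_space (approx_cycles L br (int r) p q) (boundaries L br (int r) p q)"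
  by (simp add: spectral_page_def boundaries_def)

lemma subspace_set_plus:
  fixes A B :: "'v::real_vector set"
  assumes "subspace A" "subspace B"
  shows "subspace (A + B)"
proof -
  have "A + B = {x + y |x y. x \<in> A \<and> y \<in> B}" by (auto simp: set_plus_def)
  then show ?thesis using subspace_sums[OF assms] by simp
qed

lemma subspace_boundaries: "subspace (boundaries L br r p q)"
  unfolding boundaries_def
  by (intro subspace_set_plus linear_subspace_image linear_ce_diff subspace_approx_cycles)

context lie_algebra
begin

lemma filtration_alternating: "w \<in> filtration L br p m \<Longrightarrow> w \<in> alternating L"
  using ext_power_alternating[OF subspace_L char_space_subset_dual] subspace_0[OF subspace_alternating]
  by (auto simp: filtration_def split: if_splits)

lemma approx_cycles_alternating: "w \<in> approx_cycles L br r p q \<Longrightarrow> w \<in> alternating L"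
  by (auto simp: approx_cycles_def intro: filtration_alternating)

lemma boundaries_alternating: 
  assumes "w \<in> boundaries L br r p q" shows "w \<in> alternating L"
proof -
  have "ce_diff L br x + y \<in> alternating L" if "x \<in> alternating L" "y \<in> alternating L" for x y
    using that by (intro subspace_add subspace_alternating ce_diff_alternating)
  then show ?thesis
    using assms approx_cycles_alternating by (force simp: boundaries_def set_plus_def)
qed

end

section \<open>Isomorphisms of quotient spaces\<close>

lemma elt_set_plus_eq_iff:
  fixes B :: "'v::real_vector set"
  assumes "subspace B"
  shows "x +o B = y +o B \<longleftrightarrow> x - y \<in> B"
proof
  assume "x +o B = y +o B"
  moreover have "x \<in> x +o B" using subspace_0[OF assms] by (force simp: elt_set_plus_def)
  ultimately show "x - y \<in> B" by (auto simp: elt_set_plus_def)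
next
  assume d: "x - y \<in> B"
  have "x + b \<in> y +o B" "y + b \<in> x +o B" if "b \<in> B" for b
    using subspace_add[OF assms d that] subspace_diff[OF assms that d]
    by (auto simp: set_minus_plus[symmetric] algebra_simps)
  then show "x +o B = y +o B"
    by (auto simp: elt_set_plus_def)
qed

lemma set_plus_subspace_self:
  fixes B :: "'v::real_vector set"
  assumes "subspace B"
  shows "B + B = B"
proof
  show "B + B \<subseteq> B" using subspace_add[OF assms] by (auto simp: set_plus_def)
  show "B \<subseteq> B + B" using subspace_0[OF assms] by (rule set_zero_plus2)
qed

lemma quotient_plus:
  fixes B :: "'v::real_vector set"
  assumes "subspace B"
  shows "plus_in (quotient_space A B) (x +o B) (y +o B) = (x + y) +o B"
  by (simp add: quotient_space_def set_plus_rearrange set_plus_subspace_self[OF assms])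

lemma quotient_scale:
  fixes B :: "'v::real_vector set"
  assumes "subspace B"
  shows "scale_in (quotient_space A B) c (x +o B) = (c *\<^sub>R x) +o B"
proof -
  have "(\<lambda>x. c *\<^sub>R x) ` (x +o B) + B = (c *\<^sub>R x) +o B"
  proof
    have "c *\<^sub>R b + b' \<in> B" if "b \<in> B" "b' \<in> B" for b b'
      using that assms by (simp add: subspace_add subspace_scale)
    then show "(\<lambda>x. c *\<^sub>R x) ` (x +o B) + B \<subseteq> (c *\<^sub>R x) +o B"
      by (force simp: elt_set_plus_def set_plus_def scaleR_add_right add.assoc)
    have "x \<in> x +o B" using subspace_0[OF assms] by (force simp: elt_set_plus_def)
    then show "(c *\<^sub>R x) +o B \<subseteq> (\<lambda>x. c *\<^sub>R x) ` (x +o B) + B"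
      by (auto simp: elt_set_plus_def set_plus_def)
  qed
  then show ?thesis by (simp add: quotient_space_def)
qed

lemma points_quotient: "points (quotient_space A B) = (\<lambda>x. x +o B) ` A"
  by (simp add: quotient_space_def)

lemma zero_space_quotient:
  fixes A B :: "'v::real_vector set"
  assumes "subspace A" "subspace B" "A \<subseteq> B"
  shows "zero_space (quotient_space A B)"
proof -
  have "x +o B = B" if "x \<in> A" for x
    using elt_set_plus_eq_iff[OF assms(2), of x 0] assms(3) that by auto
  moreover have "A \<noteq> {}" using subspace_0[OF assms(1)] by auto
  ultimately show ?thesis
    by (auto simp: zero_space_def quotient_space_def)
qed

text \<open>
  The homomorphism theorem: a linear map from \<open>A\<close> onto \<open>W\<close> whose kernel is \<open>A \<inter> B\<close> induces an isomorphism
  on cosets.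
\<close>

lemma quotient_iso:
  fixes A B :: "'v::real_vector set" and W :: "'w real_space"
  assumes A: "subspace A" and B: "subspace B"
    and into: "\<And>x. x \<in> A \<Longrightarrow> F x \<in> points W"
    and onto: "\<And>z. z \<in> points W \<Longrightarrow> \<exists>x\<in>A. F x = z"
    and ker: "\<And>x y. x \<in> A \<Longrightarrow> y \<in> A \<Longrightarrow> F x = F y \<longleftrightarrow> x - y \<in> B"
    and add: "\<And>x y. x \<in> A \<Longrightarrow> y \<in> A \<Longrightarrow> F (x + y) = plus_in W (F x) (F y)"
    and scale: "\<And>c x. x \<in> A \<Longrightarrow> F (c *\<^sub>R x) = scale_in W c (F x)"
  shows "isomorphic_spaces (quotient_space A B) W"
proof -
  define G where "G X = F (SOME x. x \<in> A \<and> x +o B = X)" for X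
  have G: "G (x +o B) = F x" if "x \<in> A" for x
  proof -
    have "(SOME y. y \<in> A \<and> y +o B = x +o B) \<in> A \<and> (SOME y. y \<in> A \<and> y +o B = x +o B) +o B = x +o B"
      using that by (intro someI[of "\<lambda>y. y \<in> A \<and> y +o B = x +o B" x]) simp
    then show ?thesis
      unfolding G_def using ker that elt_set_plus_eq_iff[OF B] by blast
  qed
  have "inj_on G (points (quotient_space A B))"
    by (auto simp: inj_on_def points_quotient G ker elt_set_plus_eq_iff[OF B])
  moreover have "G ` points (quotient_space A B) = points W"
    using into onto by (force simp: points_quotient G)
  moreover have "x + y \<in> A" "c *\<^sub>R x \<in> A" if "x \<in> A" "y \<in> A" for x y c
    using A that by (auto simp: subspace_def)
  ultimately show ?thesis
    unfolding isomorphic_spaces_def bij_betw_def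
    by (intro exI[of _ G])
      (auto simp: points_quotient quotient_plus[OF B] quotient_scale[OF B] G add scale)
qed

lemma isomorphic_spaces_trans:
  assumes "isomorphic_spaces U V" "isomorphic_spaces V W"
  shows "isomorphic_spaces U W"
proof -
  obtain f where f: "bij_betw f (points U) (points V)"
    "\<forall>x\<in>points U. \<forall>y\<in>points U. f (plus_in U x y) = plus_in V (f x) (f y)"
    "\<forall>c. \<forall>x\<in>points U. f (scale_in U c x) = scale_in V c (f x)"
    using assms(1) by (auto simp: isomorphic_spaces_def)
  obtain g where g: "bij_betw g (points V) (points W)"
    "\<forall>x\<in>points V. \<forall>y\<in>points V. g (plus_in V x y) = plus_in W (g x) (g y)"
    "\<forall>c. \<forall>x\<in>points V. g (scale_in V c x) = scale_in W c (g x)"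
    using assms(2) by (auto simp: isomorphic_spaces_def)
  have "f x \<in> points V" if "x \<in> points U" for x using f(1) that by (rule bij_betwE[THEN bspec])
  then show ?thesis
    unfolding isomorphic_spaces_def
    using f g bij_betw_trans[OF f(1) g(1)] by (intro exI[of _ "g \<circ> f"]) auto
qed

lemma space_sum_zero_space:
  assumes "zero_space Z"
  shows "isomorphic_spaces (space_sum V Z) V"
  unfolding isomorphic_spaces_def
  using assms
  by (intro exI[of _ fst]) (auto simp: space_sum_def zero_space_def bij_betw_def inj_on_def image_iff)

lemma space_sum_cong:
  assumes "isomorphic_spaces V W"
  shows "isomorphic_spaces (space_sum U V) (space_sum U W)"
proof -
  obtain f where f: "bij_betw f (points V) (points W)"
    "\<forall>x\<in>points V. \<forall>y\<in>points V. f (plus_in V x y) = plus_in W (f x) (f y)"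
    "\<forall>c. \<forall>x\<in>points V. f (scale_in V c x) = scale_in W c (f x)"
    using assms by (auto simp: isomorphic_spaces_def)
  have "bij_betw (map_prod id f) (points U \<times> points V) (points U \<times> points W)"
    using f(1) by (intro bij_betw_map_prod bij_betw_id)
  then show ?thesis
    unfolding isomorphic_spaces_def
    using f by (intro exI[of _ "map_prod id f"]) (auto simp: space_sum_def)
qed

section \<open>The characteristic spaces and the pages in degrees 0 and 1\<close>

lemma wedge_Nil: "wedge L [] us = (if us = [] then 1 else 0)"
  by (simp add: wedge_def)

lemma wedge_single: "wedge L [f] us = (if length us = 1 \<and> set us \<subseteq> L then f (hd us) else 0)"
proof (cases us)
  case Nil
  then show ?thesis by (simp add: wedge_def)
next
  case (Cons v vs)
  show ?thesis
  proof (cases "v \<in> L")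
    case True
    have "wedge L [f] us = contract v (wedge L [f]) vs" by (simp add: Cons)
    also have "\<dots> = f v * wedge L [] vs" by (simp add: contract_wedge[OF True])
    finally show ?thesis using True by (simp add: Cons wedge_Nil)
  qed (simp add: Cons wedge_def)
qed

lemma wedge_pair:
  assumes "u \<in> L" "v \<in> L"
  shows "wedge L [f, g] [u, v] = f u * g v - g u * f v"
proof -
  have "wedge L [f, g] [u, v] = contract u (wedge L [f, g]) [v]" by simp
  also have "\<dots> = f u * g v - g u * f v"
    using assms by (simp add: contract_wedge del: contract_apply) (simp add: wedge_single)
  finally show ?thesis .
qed

lemma ce_diff_wedge_single:
  assumes L: "lie_algebra L br"
  shows "ce_diff L br (wedge L [f]) us =
    (if length us = 2 \<and> set us \<subseteq> L then f (br (us ! 0) (us ! 1)) else 0)"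
proof (cases "length us = 2 \<and> set us \<subseteq> L")
  case True
  then obtain u v where us: "us = [u, v]" "u \<in> L" "v \<in> L"
    by (auto simp: numeral_2_eq_2 length_Suc_conv)
  have "nths [u, v] (- {0, Suc 0}) = []"
    by (simp add: nths_Cons)
  then show ?thesis
    using us lie_algebra.br_closed[OF L us(2,3)]
    by (simp add: ce_diff_def wedge_single numeral_2_eq_2)
next
  case False
  have "wedge L [f] (br (us ! i) (us ! j) # nths us (- {i, j})) = 0"
    if "j < length us" "i < j" "set us \<subseteq> L" for i j
  proof -
    have "3 \<le> length us" using False that by auto
    moreover have "\<exists>k::nat. k < 3 \<and> k \<noteq> i \<and> k \<noteq> j" by presburger
    ultimately obtain k where "k < length us" "k \<noteq> i" "k \<noteq> j"
      by (meson less_le_trans)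
    then have "us ! k \<in> set (nths us (- {i, j}))" by (auto simp: set_nths)
    then have "nths us (- {i, j}) \<noteq> []" by auto
    then show ?thesis by (simp add: wedge_single)
  qed
  then have "ce_diff L br (wedge L [f]) us = 0" by (simp add: ce_diff_def)
  then show ?thesis using False by auto
qed

lemma ext_power_mono: "W \<subseteq> W' \<Longrightarrow> ext_power L q W \<subseteq> ext_power L q W'"
  unfolding ext_power_def by (intro span_mono) blast

lemma ext_power_0: "ext_power L 0 W = range (\<lambda>c. c *\<^sub>R wedge L [])"
proof -
  have "{wedge L ws |ws. length ws = 0 \<and> set ws \<subseteq> W} = {wedge L []}" by auto
  then show ?thesis by (simp add: ext_power_def span_singleton)
qed

lemma ce_diff_wedge_Nil [simp]: "ce_diff L br (wedge L []) = 0"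
  by (simp add: fun_eq_iff ce_diff_def wedge_Nil)

lemma ce_diff_ext_power_0: "w \<in> ext_power L 0 W \<Longrightarrow> ce_diff L br w = 0"
  by (auto simp: ext_power_0)

lemma alternating_sum:
  assumes w: "w \<in> alternating L" and L: "subspace L" and "finite C" "C \<subseteq> L"
  shows "w (xs @ (\<Sum>c\<in>C. a c *\<^sub>R c) # ys) = (\<Sum>c\<in>C. a c * w (xs @ c # ys))"
  using assms(3,4)
proof (induction C rule: finite_induct)
  case empty
  then show ?case using alternating_zero[OF w subspace_0[OF L]] by simp
next
  case (insert c C)
  have "(\<Sum>c\<in>C. a c *\<^sub>R c) \<in> L" "a c *\<^sub>R c \<in> L"
    using insert.prems L by (auto intro!: subspace_sum subspace_scale)
  then show ?case
    using insert by (simp add: alternating_add[OF w] alternating_scale[OF w])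
qed

context lie_algebra
begin

text \<open>
  Extend a basis of \<open>M\<close> to a basis \<open>C\<close> of \<open>L\<close> and expand \<open>w\<close> in the wedge products of the coordinate
  functionals. Coefficients with an index in \<open>M\<close> vanish by hypothesis, and the coordinate functionals of the
  other basis vectors annihilate \<open>M\<close>.
\<close>

lemma two_form_in_ext_power:
  assumes w: "w \<in> alternating L" and two: "\<And>us. length us \<noteq> 2 \<Longrightarrow> w us = 0"
    and M: "M \<subseteq> L" and van: "\<And>u v. u \<in> L \<Longrightarrow> v \<in> M \<Longrightarrow> w [u, v] = 0"
  shows "w \<in> ext_power L 2 {f \<in> dual_space L. \<forall>x\<in>M. f x = 0}"
proof -
  let ?W = "{f \<in> dual_space L. \<forall>x\<in>M. f x = 0}"
  obtain B where B: "B \<subseteq> M" "independent B" "M \<subseteq> span B"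
    using maximal_independent_subset[of M] by blast
  obtain C where C: "B \<subseteq> C" "C \<subseteq> L" "independent C" "L \<subseteq> span C"
    using maximal_independent_subset_extend[of B L] B M by blast
  obtain F where "finite F" "span F = L" using finite_dim by blast
  then have fin: "finite C" using independent_span_bound[of F C] C by blast
  have spC: "span C = L" using C subspace_L by (simp add: span_subspace)
  define f where "f c x = (if x \<in> L then representation C x c else 0)" for c x
  have expand: "x = (\<Sum>c\<in>C. f c x *\<^sub>R c)" if "x \<in> L" for x
    using sum_representation_eq[of C x C] that C fin by (simp add: f_def spC)
  have fW: "f c \<in> ?W" if c: "c \<in> C - B" for c
  proof -
    have "f c \<in> dual_space L"
      using subspace_L C
      by (auto simp: dual_space_def f_def spC representation_add representation_scale subspace_def)
    moreover have "f c x = 0" if "x \<in> M" for x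
    proof -
      have "representation C x = representation B x"
        using that B C by (intro representation_extend) auto
      then show ?thesis using c representation_ne_zero[of B x c] by (auto simp: f_def)
    qed
    ultimately show ?thesis by simp
  qed
  have skew: "w [x, y] = - w [y, x]" for x y
    using alternating_swap[OF w subspace_L] .
  have vanB: "w [c, d] = 0" if "c \<in> C" "d \<in> C" "c \<in> B \<or> d \<in> B" for c d
    using that van[of c d] van[of d c] skew[of c d] B C by auto
  have eval: "w [u, v] = (\<Sum>c\<in>C. \<Sum>d\<in>C. f c u * f d v * w [c, d])" if uv: "u \<in> L" "v \<in> L" for u v
  proof -
    have "w [u, v] = (\<Sum>c\<in>C. f c u * w [c, v])"
      using alternating_sum[OF w subspace_L fin C(2), of "[]" "\<lambda>c. f c u" "[v]"] expand[OF uv(1)] by simp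
    moreover have "w [c, v] = (\<Sum>d\<in>C. f d v * w [c, d])" for c
      using alternating_sum[OF w subspace_L fin C(2), of "[c]" "\<lambda>c. f c v" "[]"] expand[OF uv(2)] by simp
    ultimately show ?thesis by (simp add: sum_distrib_left mult.assoc)
  qed
  \<comment> \<open>The sum counts every pair of basis vectors in both orders, hence the factor 1/2.\<close>
  have "w = (\<Sum>c\<in>C. \<Sum>d\<in>C. (w [c, d] / 2) *\<^sub>R wedge L [f c, f d])"
  proof
    fix us
    show "w us = (\<Sum>c\<in>C. \<Sum>d\<in>C. (w [c, d] / 2) *\<^sub>R wedge L [f c, f d]) us"
    proof (cases "length us = 2 \<and> set us \<subseteq> L")
      case True
      then obtain u v where us: "us = [u, v]" "u \<in> L" "v \<in> L"
        by (auto simp: numeral_2_eq_2 length_Suc_conv)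
      have "w [u, v] = (w [u, v] - w [v, u]) / 2" using skew[of u v] by simp
      also have "w [v, u] = (\<Sum>c\<in>C. \<Sum>d\<in>C. f c v * f d u * w [c, d])"
        using eval us by simp
      finally show ?thesis
        using us
        by (simp add: sum_fun_apply wedge_pair eval[OF us(2,3)] sum_subtractf[symmetric] sum_divide_distrib)
          (simp add: algebra_simps diff_divide_distrib)
    next
      case False
      then have "w us = 0" using two alternating_outside[OF w] by blast
      moreover have "wedge L [f c, f d] us = 0" for c d using False by (auto simp: wedge_def)
      ultimately show ?thesis by (simp add: sum_fun_apply)
    qed
  qed
  also have "\<dots> \<in> ext_power L 2 ?W"
  proof (intro subspace_sum subspace_ext_power)
    fix c d assume cd: "c \<in> C" "d \<in> C"
    show "(w [c, d] / 2) *\<^sub>R wedge L [f c, f d] \<in> ext_power L 2 ?W"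
    proof (cases "c \<in> B \<or> d \<in> B")
      case True
      then show ?thesis using vanB cd subspace_0[OF subspace_ext_power] by simp
    next
      case False
      then have "wedge L [f c, f d] \<in> ext_power L 2 ?W"
        unfolding ext_power_def using fW cd
        by (intro span_base CollectI exI[of _ "[f c, f d]"]) auto
      then show ?thesis by (intro subspace_scale subspace_ext_power)
    qed
  qed
  finally show ?thesis .
qed

lemma central_series_subset: "central_series L br i \<subseteq> L"
proof (induction i)
  case (Suc i)
  show ?case
    unfolding central_series.simps
    by (rule span_minimal[OF _ subspace_L]) (use Suc br_closed in blast)
qed simp

text \<open>
  If \<open>f\<close> annihilates \<open>[L, M]\<close>, with \<open>M\<close> a term of the central descending series, then
  \<open>df(u, v) = f([u, v])\<close> vanishes as soon as \<open>v \<in> M\<close>; hence \<open>df\<close> is built from the annihilator of \<open>M\<close>.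
\<close>

lemma annihilator_subset_char_space:
  "{f \<in> dual_space L. \<forall>x\<in>central_series L br i. f x = 0} \<subseteq> char_space L br i"
proof (induction i)
  case 0
  have "f = 0" if "f \<in> dual_space L" "\<forall>x\<in>L. f x = 0" for f
  proof
    fix x show "f x = 0 x" using that by (cases "x \<in> L") (auto simp: dual_space_def)
  qed
  then show ?case by auto
next
  case (Suc i)
  show ?case
  proof
    fix f assume f: "f \<in> {f \<in> dual_space L. \<forall>x\<in>central_series L br (Suc i). f x = 0}"
    have "ce_diff L br (wedge L [f]) \<in>
      ext_power L 2 {f \<in> dual_space L. \<forall>x\<in>central_series L br i. f x = 0}"
    proof (rule two_form_in_ext_power)
      show "ce_diff L br (wedge L [f]) \<in> alternating L"
        using f by (intro ce_diff_alternating wedge_alternating subspace_L) auto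
      show "central_series L br i \<subseteq> L" by (rule central_series_subset)
      fix u v assume uv: "u \<in> L" "v \<in> central_series L br i"
      then have "v \<in> L" using central_series_subset by blast
      moreover have "br u v \<in> central_series L br (Suc i)"
        using uv by (auto intro!: span_base)
      ultimately show "ce_diff L br (wedge L [f]) [u, v] = 0"
        using uv f by (simp add: ce_diff_wedge_single[OF lie_algebra_axioms])
    qed (simp add: ce_diff_wedge_single[OF lie_algebra_axioms])
    then show "f \<in> char_space L br (Suc i)"
      using f ext_power_mono[OF Suc.IH, of L 2] by auto
  qed
qed

lemma central_series_stays_zero:
  assumes "central_series L br k = {0}" "k \<le> i"
  shows "central_series L br i = {0}"
  using assms(2)
proof (induction i rule: dec_induct)
  case base
  show ?case by fact
next
  case (step i)
  then have "{br x y |x y. x \<in> L \<and> y \<in> central_series L br i} = {0}"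
    using br_zero_right zero_in_L by (auto intro: exI[of _ 0])
  then show ?case by (simp add: span_insert_0)
qed

lemma nil_index_eq:
  assumes "step_nilpotent k L br"
  shows "nil_index L br = k"
  unfolding nil_index_def
proof (rule the_equality)
  show "step_nilpotent k L br" by fact
  have "\<not> i < j" if i: "step_nilpotent i L br" and j: "step_nilpotent j L br" for i j
  proof
    assume "i < j"
    then have "central_series L br (j - 1) = {0}"
      using i central_series_stays_zero[of i "j - 1"] unfolding step_nilpotent_def by linarith
    then show False using j unfolding step_nilpotent_def by blast
  qed
  note unique = this
  show "j = k" if "step_nilpotent j L br" for j
    using unique[OF assms that] unique[OF that assms] by linarith
qed

lemma char_space_full:
  assumes "step_nilpotent k L br" "k \<le> i"
  shows "char_space L br i = dual_space L"
proof -
  have "central_series L br i = {0}"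
    using assms central_series_stays_zero by (auto simp: step_nilpotent_def)
  moreover have "f 0 = 0" if "f \<in> dual_space L" for f
    using that dual_space_scale[OF that zero_in_L, of 0] by simp
  ultimately show ?thesis
    using annihilator_subset_char_space[of i] char_space_subset_dual[of L br i] by auto
qed

lemma approx_cycles_subset_boundaries:
  "approx_cycles L br (r - 1) (p + 1) (q - 1) \<subseteq> boundaries L br r p q"
proof -
  have "0 \<in> ce_diff L br ` approx_cycles L br (r - 1) (p - r + 1) (q + r - 2)"
    using subspace_0[OF subspace_approx_cycles] ce_diff_linear(5) by (metis imageI)
  then show ?thesis unfolding boundaries_def by (rule set_zero_plus2)
qed

lemma zero_pageI:
  assumes "approx_cycles L br (int r) p q \<subseteq> boundaries L br (int r) p q"
  shows "zero_space (spectral_page L br r p q)"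
  unfolding spectral_page_eq
  by (rule zero_space_quotient[OF subspace_approx_cycles subspace_boundaries assms])

lemma approx_cycles_trivial:
  assumes "p + q < 0 \<or> p \<ge> int (nil_index L br)"
  shows "approx_cycles L br r p q = {0}"
  using assms subspace_0[OF subspace_approx_cycles, of L br r p q]
  by (auto simp: approx_cycles_def filtration_def)

lemma zero_page_of_filtration:
  assumes "p + q < 0 \<or> p \<ge> int (nil_index L br)"
  shows "zero_space (spectral_page L br r p q)"
  by (rule zero_pageI)
    (simp add: approx_cycles_trivial[OF assms] subspace_0[OF subspace_boundaries])

text \<open>
  Below the jump of the filtration at \<open>p = k - 1\<close>, the numerator \<open>F\<^sup>pC\<^sup>0 = \<real>\<close> coincides with
  \<open>F\<^sup>p\<^sup>+\<^sup>1C\<^sup>0\<close>, which is contained in the denominator.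
\<close>

lemma zero_page_degree_0:
  assumes "p \<noteq> int (nil_index L br) - 1"
  shows "zero_space (spectral_page L br r p (- p))"
proof (cases "p \<ge> int (nil_index L br)")
  case True
  then show ?thesis by (intro zero_page_of_filtration) simp
next
  case False
  then have "approx_cycles L br (int r) p (- p) \<subseteq> approx_cycles L br (int r - 1) (p + 1) (- p - 1)"
    using assms ce_diff_ext_power_0[of _ L] subspace_0[OF subspace_filtration, of L br]
    by (auto simp: approx_cycles_def filtration_def ext_power_0)
  then show ?thesis
    using approx_cycles_subset_boundaries by (intro zero_pageI) blast
qed

lemma page_degree_0_top:
  assumes k: "k = int (nil_index L br)"
  shows "isomorphic_spaces (spectral_page L br r (k - 1) (1 - k)) real_line"
proof -
  have A: "approx_cycles L br (int r) (k - 1) (1 - k) = range (\<lambda>c. c *\<^sub>R wedge L [])"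
    using subspace_0[OF subspace_filtration, of L br "k - 1 + int r" 1]
    by (auto simp: approx_cycles_def filtration_def[of _ _ "k - 1"] ext_power_0 k[symmetric])
  have "approx_cycles L br (int r - 1) (k - 1 - int r + 1) (1 - k + int r - 2) = {0}"
    "approx_cycles L br (int r - 1) (k - 1 + 1) (1 - k - 1) = {0}"
    by (intro approx_cycles_trivial; simp add: k)+
  then have B: "boundaries L br (int r) (k - 1) (1 - k) = {0}"
    unfolding boundaries_def by (simp only: image_insert image_empty ce_diff_linear set_add_0 set_zero) 
  have val: "wedge L [] [] = 1"
    by (simp add: wedge_Nil)
  show ?thesis
    unfolding spectral_page_eq B
  proof (rule quotient_iso[where F = "\<lambda>w. w []"])
    fix z :: real
    show "\<exists>w\<in>approx_cycles L br (int r) (k - 1) (1 - k). w [] = z"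
      unfolding A by (intro bexI[of _ "z *\<^sub>R wedge L []"]) (simp add: val, rule rangeI)
  next
    fix v w assume "v \<in> approx_cycles L br (int r) (k - 1) (1 - k)"
      "w \<in> approx_cycles L br (int r) (k - 1) (1 - k)"
    then obtain c d where "v = c *\<^sub>R wedge L []" "w = d *\<^sub>R wedge L []"
      unfolding A by blast
    then have "v [] = w [] \<longrightarrow> v = w"
      by (simp add: val)
    moreover have "v - w \<in> {0} \<longleftrightarrow> v = w" by simp
    ultimately show "v [] = w [] \<longleftrightarrow> v - w \<in> {0}"
      by blast
  qed (simp_all add: subspace_approx_cycles real_line_def)
qed

text \<open>
  For \<open>p < 0\<close> both \<open>F\<^sup>pC\<^sup>1\<close> and \<open>F\<^sup>p\<^sup>+\<^sup>1C\<^sup>1\<close> are the whole dual, so every approximate cycle already lies in the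
  denominator.
\<close>

lemma zero_page_degree_1:
  assumes "step_nilpotent k L br" "p < 0 \<or> p \<ge> int k"
  shows "zero_space (spectral_page L br r p (1 - p))"
proof (cases "p \<ge> int k")
  case True
  then show ?thesis using nil_index_eq[OF assms(1)] by (intro zero_page_of_filtration) simp
next
  case False
  have k: "nil_index L br = k" by (rule nil_index_eq[OF assms(1)])
  have "char_space L br (nat (int k - p)) = char_space L br (nat (int k - (p + 1)))"
    using False assms by (simp add: char_space_full[OF assms(1)])
  then have "approx_cycles L br (int r) p (1 - p) \<subseteq> approx_cycles L br (int r - 1) (p + 1) (1 - p - 1)"
    using False assms k by (auto simp: approx_cycles_def filtration_def step_nilpotent_def)
  then show ?thesis
    using approx_cycles_subset_boundaries by (intro zero_pageI) blast
qed

end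

section \<open>Splitting off a central line\<close>

text \<open>
  The direct sum of \<open>h\<close> and the central line through \<open>e\<close>; the linear functional \<open>g\<close> gives the coordinate
  along \<open>e\<close>.
\<close>

locale central_line_splitting = whole: lie_algebra n br + ideal: lie_algebra h br
  for n h :: "'a::real_vector set" and br :: "'a \<Rightarrow> 'a \<Rightarrow> 'a" +
  fixes e :: 'a and g :: "'a \<Rightarrow> real" and k :: nat
  assumes h_subset: "h \<subseteq> n" and e_in: "e \<in> n" and central: "x \<in> n \<Longrightarrow> br e x = 0"
    and linear_g: "linear g" and g_e: "g e = 1" and g_h: "x \<in> h \<Longrightarrow> g x = 0"
    and complement: "x \<in> n \<Longrightarrow> x - g x *\<^sub>R e \<in> h"
    and nilpotent: "step_nilpotent k n br"
begin

definition proj :: "'a \<Rightarrow> 'a" where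
  "proj x = x - g x *\<^sub>R e"

lemma proj_simps: "x \<in> h \<Longrightarrow> proj x = x" "proj e = 0"
  by (simp_all add: proj_def g_h g_e)

lemma proj_in_h: "x \<in> n \<Longrightarrow> proj x \<in> h"
  by (simp add: proj_def complement)

lemma br_proj: "x \<in> n \<Longrightarrow> y \<in> n \<Longrightarrow> br (proj x) (proj y) = br x y"
proof -
  assume xy: "x \<in> n" "y \<in> n"
  then have h: "proj x \<in> h" "proj y \<in> h" by (simp_all add: proj_def complement)
  then have n: "proj x \<in> n" "proj y \<in> n" using h_subset by auto
  have c: "g x *\<^sub>R e \<in> n" "g y *\<^sub>R e \<in> n" using e_in whole.subspace_L by (auto intro: subspace_scale)
  have "br x y = br (proj x + g x *\<^sub>R e) y" by (simp add: proj_def)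
  also have "\<dots> = br (proj x) y"
    using n xy c e_in by (simp only: whole.br_add_left whole.br_scale_left central) simp
  also have "\<dots> = br (proj x) (proj y + g y *\<^sub>R e)" by (simp add: proj_def)
  also have "\<dots> = br (proj x) (proj y) + g y *\<^sub>R br (proj x) e"
    using n xy c e_in by (simp only: whole.br_add_right whole.br_scale_right)
  also have "br (proj x) e = 0"
    using whole.br_skew[OF n(1) e_in] central[OF n(1)] by simp
  finally show ?thesis by simp
qed

lemma br_in_h: "x \<in> n \<Longrightarrow> y \<in> n \<Longrightarrow> br x y \<in> h"
  using ideal.br_closed complement br_proj by (metis proj_def)

text \<open>
  A bracket only depends on the projections of its entries to \<open>h\<close>. The series themselves start with
  different terms, \<open>h\<close> and \<open>n\<close>.
\<close>

lemma central_series_h: "central_series h br (Suc i) = central_series n br (Suc i)"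
proof (induction i)
  case 0
  have "br x y \<in> {br x y |x y. x \<in> h \<and> y \<in> h}" if "x \<in> n" "y \<in> n" for x y
    using proj_in_h[OF that(1)] proj_in_h[OF that(2)] br_proj[OF that, symmetric] by blast
  then have "{br x y |x y. x \<in> n \<and> y \<in> n} = {br x y |x y. x \<in> h \<and> y \<in> h}"
    using h_subset by blast
  then show ?case by simp
next
  case (Suc i)
  have "br x y \<in> {br x y |x y. x \<in> h \<and> y \<in> central_series h br (Suc i)}"
    if "x \<in> n" "y \<in> central_series h br (Suc i)" for x y
  proof -
    have y: "y \<in> h" using that(2) ideal.central_series_subset by blast
    then have "y \<in> n" using h_subset by blast
    then have "br x y = br (proj x) y"
      using br_proj[OF that(1), of y] proj_simps(1)[OF y] by simp
    then show ?thesis using proj_in_h[OF that(1)] that(2) by blast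
  qed
  then have "{br x y |x y. x \<in> n \<and> y \<in> central_series h br (Suc i)} =
      {br x y |x y. x \<in> h \<and> y \<in> central_series h br (Suc i)}"
    using h_subset by blast
  then show ?case
    using Suc.IH unfolding central_series.simps(2)[of _ _ "Suc i"] by simp
qed

lemma nilpotent_h: "step_nilpotent k h br"
proof -
  have k: "k \<ge> 1" "central_series n br k = {0}" "central_series n br (k - 1) \<noteq> {0}"
    using nilpotent by (simp_all add: step_nilpotent_def)
  have eq: "central_series h br i = central_series n br i" if "i \<ge> 1" for i
    using central_series_h[of "i - 1"] that by simp
  have "central_series h br (k - 1) \<noteq> {0}"
  proof (cases "k = 1")
    case True
    then show ?thesis using ideal.nonzero by simp
  next
    case False
    then show ?thesis using eq[of "k - 1"] k by simp
  qed
  then show ?thesis using k eq[of k] by (simp add: step_nilpotent_def)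
qed

lemma nil_index_h: "nil_index h br = nil_index n br"
  using ideal.nil_index_eq[OF nilpotent_h] whole.nil_index_eq[OF nilpotent] by simp

sublocale inclusion: lie_hom h br n br "\<lambda>x. x"
  using h_subset
  by (intro lie_hom.intro lie_hom_axioms.intro ideal.lie_algebra_axioms whole.lie_algebra_axioms
      linear_id[unfolded id_def]) auto

sublocale projection: lie_hom n br h br proj
proof (intro lie_hom.intro lie_hom_axioms.intro ideal.lie_algebra_axioms whole.lie_algebra_axioms)
  show "proj ` n \<subseteq> h" by (auto simp: proj_def complement)
  show "linear proj"
    by (rule linearI) (simp_all add: proj_def linear_add[OF linear_g] linear_scale[OF linear_g] algebra_simps)
  fix x y assume "x \<in> n" "y \<in> n"
  then show "proj (br x y) = br (proj x) (proj y)"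
    by (simp add: br_proj proj_simps br_in_h)
qed

definition coline :: "'a \<Rightarrow> real" where
  "coline x = (if x \<in> n then g x else 0)"

lemma coline_dual: "coline \<in> dual_space n"
  using whole.subspace_L
  by (auto simp: dual_space_def coline_def subspace_def linear_add[OF linear_g] linear_scale[OF linear_g])

text \<open>
  The functional dual to \<open>e\<close> is closed, because all brackets lie in \<open>h\<close>.
\<close>

lemma coline_char_space: "coline \<in> char_space n br (Suc i)"
proof -
  have "ce_diff n br (wedge n [coline]) = 0"
  proof
    fix us
    show "ce_diff n br (wedge n [coline]) us = 0 us"
      using whole.br_closed
      by (auto simp: ce_diff_wedge_single[OF whole.lie_algebra_axioms] coline_def numeral_2_eq_2
          length_Suc_conv g_h br_in_h)
  qed
  then show ?thesis using coline_dual subspace_0[OF subspace_ext_power] by simp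
qed

definition along_h :: "('a list \<Rightarrow> real) \<Rightarrow> 'a list \<Rightarrow> real" where
  "along_h = pullback (\<lambda>x. x) h"

definition along_e :: "('a list \<Rightarrow> real) \<Rightarrow> 'a list \<Rightarrow> real" where
  "along_e w = pullback (\<lambda>x. x) h (contract e w)"

lemma linear_along_h: "linear along_h"
  unfolding along_h_def by (rule linear_pullback)

lemma linear_along_e: "linear along_e"
  unfolding along_e_def by (rule linearI) simp_all

text \<open>
  The sign in the second component is the one in Cartan's formula; the Lie derivative along the
  central element \<open>e\<close> is zero.
\<close>

lemma along_ce_diff:
  "along_h (ce_diff n br w) = ce_diff h br (along_h w)"
  "w \<in> alternating n \<Longrightarrow> along_e (ce_diff n br w) = - ce_diff h br (along_e w)"
  using whole.lie_derivative_central[OF central]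
  by (simp_all add: along_h_def along_e_def inclusion.ce_diff_pullback
      cartan_formula[OF whole.subspace_L _ e_in])

text \<open>
  Splitting each argument into its part in \<open>h\<close> and its multiple of \<open>e\<close> reduces the values of \<open>w\<close> to those
  on lists with entries in \<open>h\<close> and \<open>e\<close>. Alternation disposes of repeated \<open>e\<close> and moves a single \<open>e\<close> to
  the front. The induction on the list performs this one argument at a time, by passing from \<open>w\<close> to
  its contractions.
\<close>

lemma eq_0_if_components_0:
  assumes w: "w \<in> alternating n" and 0: "along_h w = 0" "along_e w = 0"
  shows "w = 0"
proof
  fix us
  have vanish: "w us = 0"
    if "w \<in> alternating n" "\<forall>vs. set vs \<subseteq> h \<longrightarrow> w vs = 0 \<and> w (e # vs) = 0" "set us \<subseteq> n" for w us
    using that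
  proof (induction us arbitrary: w)
    case Nil
    then show ?case by simp
  next
    case (Cons u us)
    note w = Cons.prems(1)
    have u: "u \<in> n" and y: "proj u \<in> h" and us: "set us \<subseteq> n"
      using Cons.prems(3) by (simp_all add: proj_def complement)
    have "contract e w us = 0"
      using Cons.prems(2) alternating_head_simps(3)[OF w]
      by (intro Cons.IH[of "contract e w"] contract_alternating[OF w] us) simp
    moreover have "contract (proj u) w us = 0"
    proof (intro Cons.IH[of "contract (proj u) w"] contract_alternating[OF w] us allI impI conjI)
      fix vs assume vs: "set vs \<subseteq> h"
      then show "contract (proj u) w vs = 0" using Cons.prems(2) y by simp
      have "w (proj u # e # vs) = - w (e # proj u # vs)"
        by (rule alternating_swap[OF w whole.subspace_L])
      then show "contract (proj u) w (e # vs) = 0" using Cons.prems(2) y vs by simp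
    qed
    moreover have "w ((proj u + g u *\<^sub>R e) # us) = w (proj u # us) + g u * w (e # us)"
      using y h_subset e_in subspace_scale[OF whole.subspace_L e_in]
      by (subst alternating_head_simps(1)[OF w]) (auto simp: alternating_head_simps(2)[OF w])
    ultimately show ?case by (simp add: proj_def)
  qed
  have "w vs = 0 \<and> w (e # vs) = 0" if "set vs \<subseteq> h" for vs
    using fun_cong[OF 0(1), of vs] fun_cong[OF 0(2), of vs] that
    by (simp add: along_h_def along_e_def pullback_def)
  then have "w us = 0" if "set us \<subseteq> n"
    using vanish[OF w _ that] by blast
  then show "w us = 0 us"
    using alternating_outside[OF w, of us] by auto
qed

text \<open>
  Contraction by \<open>e\<close> removes one factor of a wedge product in each term of the Laplace expansion.
\<close>

lemma along_e_ext_power: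
  assumes "\<And>f. f \<in> W \<Longrightarrow> dual_map (\<lambda>x. x) h f \<in> W'" and w: "w \<in> ext_power n (Suc m) W"
  shows "along_e w \<in> ext_power h m W'"
  using w unfolding ext_power_def[of n]
proof (rule span_induct)
  show "subspace {w. along_e w \<in> ext_power h m W'}"
    using linear_subspace_vimage[OF linear_along_e subspace_ext_power] by (simp add: vimage_def)
next
  fix v assume "v \<in> {wedge n ws |ws. length ws = Suc m \<and> set ws \<subseteq> W}"
  then obtain ws where ws: "v = wedge n ws" "length ws = Suc m" "set ws \<subseteq> W" by auto
  have "along_e v = (\<Sum>i<length ws. ((-1) ^ i * (ws ! i) e) *\<^sub>R
      wedge h (map (dual_map (\<lambda>x. x) h) (take i ws @ drop (Suc i) ws)))"
    using h_subset
    by (simp add: along_e_def ws(1) contract_wedge[OF e_in] linear_sum[OF linear_pullback] pullback_wedge)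
  also have "\<dots> \<in> ext_power h m W'"
  proof (intro subspace_sum subspace_scale subspace_ext_power)
    fix i assume i: "i \<in> {..<length ws}"
    let ?ws = "take i ws @ drop (Suc i) ws"
    have "set ?ws \<subseteq> W"
      using ws(3) set_take_subset[of i ws] set_drop_subset[of "Suc i" ws] by auto
    then have "set (map (dual_map (\<lambda>x. x) h) ?ws) \<subseteq> W'"
      using assms(1) by auto
    moreover have "length ?ws = m" using i ws(2) by auto
    ultimately show "wedge h (map (dual_map (\<lambda>x. x) h) ?ws) \<in> ext_power h m W'"
      unfolding ext_power_def by (intro span_base CollectI exI[of _ "map (dual_map (\<lambda>x. x) h) ?ws"]) auto
  qed
  finally show "along_e v \<in> ext_power h m W'" .
qed

lemma dual_map_proj:
  assumes "f \<in> dual_space h"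
  shows "dual_map (\<lambda>x. x) h (dual_map proj n f) = f"
  using assms h_subset by (auto simp: fun_eq_iff dual_map_def dual_space_def proj_simps)

text \<open>
  On wedge products, the preimage of \<open>b\<close> is the wedge of the functional dual to \<open>e\<close> with the pullback of
  \<open>b\<close> to \<open>n\<close>.
\<close>

lemma lift_along_e:
  assumes W': "W' \<subseteq> dual_space h" and W: "\<And>f. f \<in> W' \<Longrightarrow> dual_map proj n f \<in> W" "coline \<in> W"
    and b: "b \<in> ext_power h m W'"
  shows "\<exists>w\<in>ext_power n (Suc m) W. along_h w = 0 \<and> along_e w = b"
proof -
  let ?E = "ext_power n (Suc m) W"
  have "b \<in> along_e ` (?E \<inter> {w. along_h w = 0})"
    using b unfolding ext_power_def[of h]
  proof (rule span_induct)
    have "subspace (along_e ` (?E \<inter> {w. along_h w = 0}))"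
      by (intro linear_subspace_image linear_along_e subspace_inter subspace_ext_power
          linear_subspace_kernel linear_along_h)
    then show "subspace {b. b \<in> along_e ` (?E \<inter> {w. along_h w = 0})}" by simp
  next
    fix v assume "v \<in> {wedge h ws |ws. length ws = m \<and> set ws \<subseteq> W'}"
    then obtain ws where ws: "v = wedge h ws" "length ws = m" "set ws \<subseteq> W'" by auto
    let ?ws = "map (dual_map proj n) ws"
    let ?w = "wedge n (coline # ?ws)"
    have dual: "ws ! i \<in> dual_space h" if "i < length ws" for i
      using ws(3) W' nth_mem[OF that] by blast
    have zero: "(ws ! i) 0 = 0" if "i < length ws" for i
      using dual_space_scale[OF dual[OF that] ideal.zero_in_L, of 0] by simp
    have restr: "map (dual_map (\<lambda>x. x) h) ?ws = ws"
      using W' ws(3) dual_map_proj unfolding map_map by (intro map_idI) auto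
    have "?w \<in> ?E"
      unfolding ext_power_def using ws W
      by (intro span_base CollectI exI[of _ "coline # ?ws"]) auto
    moreover have "along_h ?w = 0"
    proof -
      \<comment> \<open>The functional dual to \<open>e\<close> vanishes on \<open>h\<close>, so the determinant has a zero row.\<close>
      have c0: "dual_map (\<lambda>x. x) h coline = 0"
        using h_subset by (auto simp: fun_eq_iff dual_map_def coline_def g_h)
      have "along_h ?w = wedge h (0 # ws)"
        using h_subset restr c0 by (simp add: along_h_def pullback_wedge)
      also have "wedge h (0 # ws) = 0"
      proof
        fix us
        show "wedge h (0 # ws) us = 0 us"
        proof (cases us)
          case (Cons u us')
          have "length us = Suc (length ws) \<Longrightarrow>
            det (mat (Suc (length ws)) (Suc (length ws)) (\<lambda>(i, j). ((0 # ws) ! i) (us ! j))) = 0"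
            by (subst laplace_expansion_row[of _ "Suc (length ws)" 0]) auto
          then show ?thesis by (simp add: wedge_def)
        qed (simp add: wedge_def)
      qed
      finally show ?thesis .
    qed
    moreover have "along_e ?w = v"
    proof -
      have "along_e ?w = (\<Sum>i<length (coline # ?ws). ((-1) ^ i * ((coline # ?ws) ! i) e) *\<^sub>R
        along_h (wedge n (take i (coline # ?ws) @ drop (Suc i) (coline # ?ws))))"
        by (simp only: along_e_def along_h_def contract_wedge[OF e_in] linear_sum[OF linear_pullback]
            pullback_linear)
      \<comment> \<open>Only the first factor of the wedge product is nonzero at \<open>e\<close>.\<close>
      also have "\<dots> = along_h (wedge n ?ws)"
        using e_in by (simp add: sum.lessThan_Suc_shift coline_def g_e dual_map_def proj_simps zero
            del: sum.lessThan_Suc)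
      also have "\<dots> = v"
        using h_subset restr by (simp add: along_h_def pullback_wedge ws(1))
      finally show ?thesis .
    qed
    ultimately show "v \<in> along_e ` (?E \<inter> {w. along_h w = 0})" by force
  qed
  then show ?thesis by auto
qed

lemma along_pullback_proj:
  assumes a: "a \<in> alternating h"
  shows "along_h (pullback proj n a) = a" "along_e (pullback proj n a) = 0"
proof -
  show "along_h (pullback proj n a) = a"
  proof
    fix us
    have "map proj us = us" if "set us \<subseteq> h" using that by (auto intro: map_idI proj_simps)
    then show "along_h (pullback proj n a) us = a us"
      using h_subset alternating_outside[OF a, of us]
      by (auto simp: along_h_def pullback_def)
  qed
  show "along_e (pullback proj n a) = 0"
    using alternating_zero[OF a ideal.zero_in_L, of "[]"]
    by (auto simp: fun_eq_iff along_e_def pullback_def proj_simps)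
qed

lemma along_filtration:
  assumes w: "w \<in> filtration n br p m"
  shows "along_h w \<in> filtration h br p m" "along_e w \<in> filtration h br p (m - 1)"
proof -
  show "along_h w \<in> filtration h br p m"
    unfolding along_h_def by (rule inclusion.pullback_filtration[OF nil_index_h w])
  show "along_e w \<in> filtration h br p (m - 1)"
  proof (cases "m \<le> 0 \<or> p \<ge> int (nil_index n br)")
    case True
    have "along_e (wedge n []) = 0"
      by (simp add: fun_eq_iff along_e_def pullback_def wedge_Nil)
    then have "along_e w = 0"
      using True w linear_0[OF linear_along_e] linear_scale[OF linear_along_e]
      by (cases "m < 0 \<or> p \<ge> int (nil_index n br)") (auto simp: filtration_def ext_power_0)
    then show ?thesis using subspace_0[OF subspace_filtration] by simp
  next
    case False
    then have "nat m = Suc (nat (m - 1))" by linarith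
    then have "w \<in> ext_power n (Suc (nat (m - 1))) (char_space n br (nat (int (nil_index n br) - p)))"
      using False w by (simp add: filtration_def)
    from along_e_ext_power[OF inclusion.dual_map_char_space this] False show ?thesis
      by (simp add: filtration_def nil_index_h)
  qed
qed

text \<open>
  The pullback of \<open>a\<close> along the projection has components \<open>a\<close> and \<open>0\<close>; it remains to add a form with
  components \<open>0\<close> and \<open>b\<close>.
\<close>

lemma filtration_lift:
  assumes a: "a \<in> filtration h br p m" and b: "b \<in> filtration h br p (m - 1)"
  shows "\<exists>w\<in>filtration n br p m. along_h w = a \<and> along_e w = b"
proof -
  have "pullback proj n a \<in> filtration n br p m"
    by (rule projection.pullback_filtration[OF nil_index_h[symmetric] a])
  moreover note along_pullback_proj[OF ideal.filtration_alternating[OF a]]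
  moreover have "\<exists>v\<in>filtration n br p m. along_h v = 0 \<and> along_e v = b"
  proof (cases "m \<le> 0 \<or> p \<ge> int (nil_index n br)")
    case True
    then have "b = 0" using b nil_index_h by (auto simp: filtration_def)
    then show ?thesis
      using subspace_0[OF subspace_filtration] linear_0[OF linear_along_h] linear_0[OF linear_along_e]
      by (intro bexI[of _ 0]) auto
  next
    case False
    \<comment> \<open>Here \<open>i \<ge> 1\<close>, so \<open>V\<^sub>i\<close> of \<open>n\<close> contains the functional dual to \<open>e\<close>.\<close>
    define i where "i = nat (int (nil_index n br) - p)"
    have i: "i = Suc (i - 1)" using False by (simp add: i_def)
    have m: "nat m = Suc (nat (m - 1))" using False by linarith
    have "b \<in> ext_power h (nat (m - 1)) (char_space h br i)"
      using b False by (simp add: filtration_def nil_index_h i_def)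
    moreover have "coline \<in> char_space n br i" using coline_char_space i by metis
    ultimately have "\<exists>v\<in>ext_power n (Suc (nat (m - 1))) (char_space n br i). along_h v = 0 \<and> along_e v = b"
      by (intro lift_along_e[OF char_space_subset_dual projection.dual_map_char_space])
    then show ?thesis using False m by (simp add: filtration_def i_def)
  qed
  then obtain v where "v \<in> filtration n br p m" "along_h v = 0" "along_e v = b" by auto
  ultimately show ?thesis
    by (intro bexI[of _ "pullback proj n a + v"])
      (simp_all add: linear_add[OF linear_along_h] linear_add[OF linear_along_e]
        subspace_add[OF subspace_filtration])
qed

lemma alternating_eqI:
  assumes "v \<in> alternating n" "w \<in> alternating n" "along_h v = along_h w" "along_e v = along_e w"
  shows "v = w"
  using eq_0_if_components_0[of "v - w"] assms
  by (simp add: subspace_diff[OF subspace_alternating] linear_diff[OF linear_along_h]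
      linear_diff[OF linear_along_e])

text \<open>
  Membership can be tested on components: lift the components of \<open>w\<close> into the filtration, and the
  lift equals \<open>w\<close> by injectivity.
\<close>

lemma filtration_iff:
  "w \<in> filtration n br p m \<longleftrightarrow>
    w \<in> alternating n \<and> along_h w \<in> filtration h br p m \<and> along_e w \<in> filtration h br p (m - 1)"
proof
  assume "w \<in> filtration n br p m"
  then show "w \<in> alternating n \<and> along_h w \<in> filtration h br p m \<and> along_e w \<in> filtration h br p (m - 1)"
    using along_filtration whole.filtration_alternating by blast
next
  assume w: "w \<in> alternating n \<and> along_h w \<in> filtration h br p m \<and> along_e w \<in> filtration h br p (m - 1)"
  then obtain v where "v \<in> filtration n br p m" "along_h v = along_h w" "along_e v = along_e w"
    using filtration_lift by blast
  then show "w \<in> filtration n br p m"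
    using alternating_eqI[of v w] w whole.filtration_alternating by auto
qed

text \<open>
  The condition on \<open>dw\<close> also splits into components, since \<open>dw\<close> is alternating and its components are,
  up to sign, the differentials of the components of \<open>w\<close>.
\<close>

lemma approx_cycles_iff:
  "w \<in> approx_cycles n br r p q \<longleftrightarrow>
    w \<in> alternating n \<and> along_h w \<in> approx_cycles h br r p q \<and> along_e w \<in> approx_cycles h br r p (q - 1)"
proof -
  have "- x \<in> filtration h br p' m \<longleftrightarrow> x \<in> filtration h br p' m" for x p' m
    by (metis subspace_neg[OF subspace_filtration] minus_minus)
  moreover have "p + q - 1 = p + (q - 1)" "p + q + 1 - 1 = p + (q - 1) + 1" by simp_all
  ultimately show ?thesis
    using whole.ce_diff_alternating[of w]
    by (auto simp only: approx_cycles_def filtration_iff along_ce_diff mem_Collect_eq)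
qed

lemma approx_cycles_lift:
  assumes a: "a \<in> approx_cycles h br r p q" and b: "b \<in> approx_cycles h br r p (q - 1)"
  shows "\<exists>w\<in>approx_cycles n br r p q. along_h w = a \<and> along_e w = b"
proof -
  have "b \<in> filtration h br p (p + q - 1)"
    using b by (simp add: approx_cycles_def add_diff_eq)
  then obtain w where "w \<in> filtration n br p (p + q)" "along_h w = a" "along_e w = b"
    using a filtration_lift[of a p "p + q" b] by (auto simp: approx_cycles_def)
  then show ?thesis
    using a b whole.filtration_alternating by (auto simp: approx_cycles_iff)
qed

text \<open>
  Each component of \<open>w\<close> is a differential plus a second summand. Lifting the primitives and the summands
  separately yields an element of the denominator with the components of \<open>w\<close>, hence \<open>w\<close> itself.
\<close>

lemma boundaries_iff:
  "w \<in> boundaries n br r p q \<longleftrightarrow>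
    w \<in> alternating n \<and> along_h w \<in> boundaries h br r p q \<and> along_e w \<in> boundaries h br r p (q - 1)"
proof
  assume w: "w \<in> boundaries n br r p q"
  then obtain x y where w_eq: "w = ce_diff n br x + y"
    and x: "x \<in> approx_cycles n br (r - 1) (p - r + 1) (q + r - 2)"
    and y: "y \<in> approx_cycles n br (r - 1) (p + 1) (q - 1)"
    by (auto simp: boundaries_def set_plus_def)
  have x': "x \<in> alternating n" "along_h x \<in> approx_cycles h br (r - 1) (p - r + 1) (q + r - 2)"
    "- along_e x \<in> approx_cycles h br (r - 1) (p - r + 1) (q - 1 + r - 2)"
    using x by (auto simp: approx_cycles_iff algebra_simps intro!: subspace_neg subspace_approx_cycles)
  have y': "along_h y \<in> approx_cycles h br (r - 1) (p + 1) (q - 1)"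
    "along_e y \<in> approx_cycles h br (r - 1) (p + 1) (q - 1 - 1)"
    using y by (auto simp: approx_cycles_iff)
  have "along_h w = ce_diff h br (along_h x) + along_h y"
    by (simp add: w_eq linear_add[OF linear_along_h] along_ce_diff)
  moreover have "along_e w = ce_diff h br (- along_e x) + along_e y"
    using x' by (simp add: w_eq linear_add[OF linear_along_e] along_ce_diff)
  ultimately show "w \<in> alternating n \<and> along_h w \<in> boundaries h br r p q \<and>
      along_e w \<in> boundaries h br r p (q - 1)"
    using whole.boundaries_alternating[OF w] x' y' unfolding boundaries_def
    by (metis imageI set_plus_intro)
next
  assume w: "w \<in> alternating n \<and> along_h w \<in> boundaries h br r p q \<and> along_e w \<in> boundaries h br r p (q - 1)"
  obtain a a' where a: "along_h w = ce_diff h br a + a'"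
    "a \<in> approx_cycles h br (r - 1) (p - r + 1) (q + r - 2)"
    "a' \<in> approx_cycles h br (r - 1) (p + 1) (q - 1)"
    using w by (auto simp: boundaries_def set_plus_def)
  obtain b b' where b: "along_e w = ce_diff h br b + b'"
    "b \<in> approx_cycles h br (r - 1) (p - r + 1) (q - 1 + r - 2)"
    "b' \<in> approx_cycles h br (r - 1) (p + 1) (q - 1 - 1)"
    using w by (auto simp: boundaries_def set_plus_def)
  \<comment> \<open>The sign compensates for the one with which the second component commutes with the differential.\<close>
  have "- b \<in> approx_cycles h br (r - 1) (p - r + 1) (q + r - 2 - 1)"
    using subspace_neg[OF subspace_approx_cycles b(2)] by (simp add: algebra_simps)
  then obtain x where x: "x \<in> approx_cycles n br (r - 1) (p - r + 1) (q + r - 2)"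
      "along_h x = a" "along_e x = - b"
    using approx_cycles_lift[OF a(2)] by blast
  obtain y where y: "y \<in> approx_cycles n br (r - 1) (p + 1) (q - 1)"
      "along_h y = a'" "along_e y = b'"
    using approx_cycles_lift[OF a(3) b(3)] by blast
  have xy: "ce_diff n br x + y \<in> boundaries n br r p q"
    using x y by (auto simp: boundaries_def)
  have "along_h (ce_diff n br x + y) = along_h w"
    by (simp add: linear_add[OF linear_along_h] along_ce_diff x y a)
  moreover have "along_e (ce_diff n br x + y) = along_e w"
    using whole.approx_cycles_alternating[OF x(1)]
    by (simp add: linear_add[OF linear_along_e] along_ce_diff x y b)
  ultimately have "ce_diff n br x + y = w"
    using alternating_eqI whole.boundaries_alternating[OF xy] w by blast
  with xy show "w \<in> boundaries n br r p q" by simp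
qed

text \<open>
  The pair of components maps the numerator of the page of \<open>n\<close> onto the product of the two numerators,
  and the preimage of the product of the two denominators is the denominator.
\<close>

theorem page_splitting:
  "isomorphic_spaces (spectral_page n br r p q)
    (space_sum (spectral_page h br r p q) (spectral_page h br r p (q - 1)))"
proof -
  let ?A = "approx_cycles n br (int r) p q"
  let ?B1 = "boundaries h br (int r) p q" and ?B2 = "boundaries h br (int r) p (q - 1)"
  show ?thesis
    unfolding spectral_page_eq
  proof (rule quotient_iso[where F = "\<lambda>w. (along_h w +o ?B1, along_e w +o ?B2)"])
    fix w assume "w \<in> ?A"
    then show "(along_h w +o ?B1, along_e w +o ?B2) \<in> points (space_sum
        (quotient_space (approx_cycles h br (int r) p q) ?B1)
        (quotient_space (approx_cycles h br (int r) p (q - 1)) ?B2))"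
      by (simp add: space_sum_def points_quotient approx_cycles_iff)
  next
    fix z assume "z \<in> points (space_sum
        (quotient_space (approx_cycles h br (int r) p q) ?B1)
        (quotient_space (approx_cycles h br (int r) p (q - 1)) ?B2))"
    then obtain a b where z: "z = (a +o ?B1, b +o ?B2)" "a \<in> approx_cycles h br (int r) p q"
      "b \<in> approx_cycles h br (int r) p (q - 1)"
      by (auto simp: space_sum_def points_quotient)
    then show "\<exists>w\<in>?A. (along_h w +o ?B1, along_e w +o ?B2) = z"
      using approx_cycles_lift[OF z(2,3)] by auto
  next
    fix v w assume "v \<in> ?A" "w \<in> ?A"
    then have "v - w \<in> alternating n"
      by (simp add: approx_cycles_iff subspace_diff[OF subspace_alternating])
    then show "(along_h v +o ?B1, along_e v +o ?B2) = (along_h w +o ?B1, along_e w +o ?B2) \<longleftrightarrow>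
        v - w \<in> boundaries n br (int r) p q"
      by (simp add: elt_set_plus_eq_iff[OF subspace_boundaries] boundaries_iff
          linear_diff[OF linear_along_h] linear_diff[OF linear_along_e])
  qed (simp_all add: subspace_approx_cycles subspace_boundaries space_sum_def
      quotient_plus[OF subspace_boundaries] quotient_scale[OF subspace_boundaries]
      linear_add[OF linear_along_h] linear_add[OF linear_along_e]
      linear_scale[OF linear_along_h] linear_scale[OF linear_along_e])
qed

end

section \<open>Ideals with a one-dimensional complement\<close>

lemma lie_ideal_is_lie_algebra:
  assumes n: "lie_algebra n br" and h: "lie_ideal n br h" "h \<noteq> {0}"
  shows "lie_algebra h br"
proof -
  interpret lie_algebra n br by fact
  have sub: "subspace h" "h \<subseteq> n" and closed: "\<And>x y. x \<in> n \<Longrightarrow> y \<in> h \<Longrightarrow> br x y \<in> h"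
    using h by (auto simp: lie_ideal_def)
  have dom: "x \<in> n" if "x \<in> h" for x using that sub by blast
  obtain B where B: "B \<subseteq> h" "independent B" "h \<subseteq> span B"
    using maximal_independent_subset[of h] by blast
  obtain F where "finite F" "span F = n" using finite_dim by blast
  then have "finite B" using independent_span_bound[of F B] B sub by blast
  moreover have "span B = h" using B sub by (simp add: span_subspace)
  ultimately have "\<exists>B. finite B \<and> span B = h" by blast
  then show ?thesis
    using h(2) sub(1) closed
    by unfold_locales
      (simp_all add: dom br_add_left br_add_right br_scale_left br_scale_right br_self jacobi)
qed

text \<open>
  For \<open>y \<in> h\<close> the bracket \<open>[e, y]\<close> lies in both ideals, hence it is zero and \<open>e\<close> is central.
\<close>

lemma central_line_splitting_exists:
  fixes n a h :: "'a::real_vector set"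
  assumes n: "lie_algebra n br" and nil: "step_nilpotent k n br"
    and a: "lie_ideal n br a" and h: "lie_ideal n br h"
    and sum: "a + h = n" and int: "a \<inter> h = {0}" and dim: "dim a = 1" and h0: "h \<noteq> {0}"
  shows "\<exists>e g. central_line_splitting n h br e g k"
proof -
  interpret lie_algebra n br by fact
  have sub: "subspace a" "a \<subseteq> n" "subspace h" "h \<subseteq> n" using a h by (auto simp: lie_ideal_def)
  obtain A where A: "A \<subseteq> a" "independent A" "a \<subseteq> span A" "card A = dim a"
    using basis_exists[of a] by blast
  then obtain e where e: "A = {e}" using dim by (metis card_1_singletonE)
  have a_eq: "a = span {e}" using A sub span_subspace unfolding e by blast
  have "e \<noteq> 0" using A dependent_zero unfolding e by blast
  then have "e \<notin> h" using A int unfolding e by blast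
  obtain B where B: "B \<subseteq> h" "independent B" "h \<subseteq> span B"
    using maximal_independent_subset[of h] by blast
  have spB: "span B = h" using B sub by (simp add: span_subspace)
  then have "independent (insert e B)"
    using B \<open>e \<notin> h\<close> by (simp add: independent_insertI)
  from linear_independent_extend[OF this, of "\<lambda>x. if x = e then 1 else 0 :: real"]
  obtain g where g: "linear g" "\<forall>x\<in>insert e B. g x = (if x = e then 1 else 0 :: real)"
    by blast
  have ge: "g e = 1" using g by simp
  have gB: "g x = 0" if "x \<in> B" for x
    using g that B \<open>e \<notin> h\<close> by auto
  have gh: "g x = 0" if "x \<in> h" for x
    using linear_eq_0_on_span[OF g(1) gB, of B x] that spB by simp
  have decomp: "\<exists>c y. x = c *\<^sub>R e + y \<and> y \<in> h" if "x \<in> n" for x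
    using that sum a_eq by (auto simp: set_plus_def span_singleton)
  have "central_line_splitting n h br e g k"
  proof (rule central_line_splitting.intro[OF n lie_ideal_is_lie_algebra[OF n h h0]],
      rule central_line_splitting_axioms.intro)
    show "h \<subseteq> n" "linear g" "g e = 1" "step_nilpotent k n br" by fact+
    show "g x = 0" if "x \<in> h" for x using that by (rule gh)
    show "e \<in> n" using A sub unfolding e by blast
    note e_in = this
    show "x - g x *\<^sub>R e \<in> h" if xn: "x \<in> n" for x
    proof -
      obtain c y where "x = c *\<^sub>R e + y" "y \<in> h" using decomp[OF xn] by blast
      then show ?thesis by (simp add: linear_add[OF g(1)] linear_scale[OF g(1)] ge gh)
    qed
    show "br e x = 0" if xn: "x \<in> n" for x
    proof -
      obtain c y where x: "x = c *\<^sub>R e + y" "y \<in> h" using decomp[OF xn] by blast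
      have y: "y \<in> n" and c: "c *\<^sub>R e \<in> n"
        using x sub e_in subspace_scale[OF subspace_L] by auto
      have "br e y \<in> h" using h e_in x by (simp add: lie_ideal_def)
      moreover have "br y e \<in> a" using a y A unfolding e by (simp add: lie_ideal_def)
      then have "br e y \<in> a" using br_skew[OF e_in y] subspace_neg[OF sub(1)] by simp
      ultimately have "br e y = 0" using int by blast
      then show ?thesis
        unfolding x(1) by (simp add: br_add_right[OF e_in c y] br_scale_right[OF e_in e_in] br_self[OF e_in])
    qed
  qed
  then show ?thesis by blast
qed

theorem theorem3p3:
  fixes n a h :: "'a::real_vector set" and br :: "'a \<Rightarrow> 'a \<Rightarrow> 'a" and k :: nat
  assumes "lie_algebra n br"
    and "step_nilpotent k n br"
    and "lie_ideal n br a" and "lie_ideal n br h"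
    and "a + h = n" and "a \<inter> h = {0}"
    and "dim a = 1" and "h \<noteq> {0}"
  shows "\<forall>(r::nat) (p::int) (q::int).
    (p + q < 0 \<longrightarrow> zero_space (spectral_page n br r p q)) \<and>
    (isomorphic_spaces (spectral_page n br r (int k - 1) (1 - int k)) real_line \<and>
      (p \<noteq> int k - 1 \<longrightarrow> zero_space (spectral_page n br r p (- p)))) \<and>
    isomorphic_spaces (spectral_page n br r (int k - 1) (2 - int k))
      (space_sum (spectral_page h br r (int k - 1) (2 - int k)) real_line) \<and>
    ((0 \<le> p \<and> p \<le> int k - 2 \<longrightarrow>
        isomorphic_spaces (spectral_page n br r p (1 - p)) (spectral_page h br r p (1 - p))) \<and>
      (p < 0 \<or> p \<ge> int k \<longrightarrow> zero_space (spectral_page n br r p (1 - p)))) \<and>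
    (p + q \<ge> 2 \<longrightarrow>
      isomorphic_spaces (spectral_page n br r p q)
        (space_sum (spectral_page h br r p q) (spectral_page h br r p (q - 1))))"
proof -
  obtain e g where "central_line_splitting n h br e g k"
    using central_line_splitting_exists assms by blast
  then interpret central_line_splitting n h br e g k .
  have k: "nil_index n br = k" "nil_index h br = k"
    using whole.nil_index_eq[OF nilpotent] ideal.nil_index_eq[OF nilpotent_h] .
  have top: "isomorphic_spaces (spectral_page n br r (int k - 1) (2 - int k))
      (space_sum (spectral_page h br r (int k - 1) (2 - int k)) real_line)" for r
    using isomorphic_spaces_trans[OF page_splitting[of r "int k - 1" "2 - int k"] space_sum_cong]
      ideal.page_degree_0_top[of "int k" r] k by simp
  have low: "isomorphic_spaces (spectral_page n br r p (1 - p)) (spectral_page h br r p (1 - p))"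
    if "p \<le> int k - 2" for r p
    using isomorphic_spaces_trans[OF page_splitting[of r p "1 - p"] space_sum_zero_space]
      ideal.zero_page_degree_0[of p r] that k by simp
  show ?thesis
    using whole.zero_page_of_filtration whole.page_degree_0_top[of "int k"]
      whole.zero_page_degree_0 top low whole.zero_page_degree_1[OF nilpotent] page_splitting k
    by (intro allI conjI impI) simp_all
qed

end
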